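(* Let $K\subset\mathbb{R}^d$ ($d=2,3$) be a simplex with set of faces $\mathcal{F}_K$, let $\mathrm{p}\ge0$, and let $\kappa_K>0$, $\eta_K>0$ be real constants. For each $F\in\mathcal{F}_K$ let $\mathcal{A}_F:\mathcal{P}_\mathrm{p}(F)\to\mathcal{P}_\mathrm{p}(F)$ be a linear operator that is positive and self-adjoint. Given data $\widehat{p}_F\in\mathcal{P}_\mathrm{p}(F)$ for all $F\in\mathcal{F}_K$, consider the problem: find $(p_K,\mathbf{u}_K)\in\mathcal{P}_\mathrm{p}(K)\times\boldsymbol{\mathcal{P}}_\mathrm{p}(K)$ such that for all $(q_K,\mathbf{v}_K)\in\mathcal{P}_\mathrm{p}(K)\times\boldsymbol{\mathcal{P}}_\mathrm{p}(K)$, $$-\imath(\kappa_K\eta_K^{-1}p_K,q_K)_K-(\mathbf{u}_K,\nabla q_K)_K+\sum_{F\in\mathcal{F}_K}\langle \mathbf{n}_{K,F}\cdot\mathbf{u}_K+\mathcal{A}_F^{-1}p_K,\,q_K\rangle_F=\sum_{F\in\mathcal{F}_K}\langle\mathcal{A}_F^{-1}\widehat{p}_F,q_K\rangle_F,$$ $$-\imath(\kappa_K\eta_K\mathbf{u}_K,\mathbf{v}_K)_K-(p_K,\nabla\cdot\mathbf{v}_K)_K=-\sum_{F\in\mathcal{F}_K}\langle\widehat{p}_F,\mathbf{n}_{K,F}\cdot\mathbf{v}_K\rangle_F.$$ Then this problem is well-posed: for every choice of data it has a unique solution.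
   Context: $\mathcal{P}_\mathrm{p}(\cdot)$ and $\boldsymbol{\mathcal{P}}_\mathrm{p}(\cdot)$ denote spaces of complex-valued scalar and $\mathbb{C}^d$-valued polynomials of degree at most $\mathrm{p}$. $(u,v)_K:=\int_K u\overline{v}\,dx$, $(\mathbf{u},\mathbf{v})_K:=\int_K\mathbf{u}\cdot\overline{\mathbf{v}}\,dx$, $\langle u,v\rangle_F:=\int_F u\overline{v}\,d\sigma$. $\mathbf{n}_{K,F}$ is the (constant) unit normal to $F$ pointing outward from $K$; traces of $p_K$ and $\mathbf{n}_{K,F}\cdot\mathbf{u}_K$ on $F$ belong to $\mathcal{P}_\mathrm{p}(F)$, so $\mathcal{A}_F^{\pm1}$ may be applied to them. "Positive" for $\mathcal{A}_F$ means $\langle\mathcal{A}_F\phi,\phi\rangle_F>0$ for all nonzero $\phi\in\mathcal{P}_\mathrm{p}(F)$; self-adjoint is with respect to $\langle\cdot,\cdot\rangle_F$. *)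

theory Defs
  imports "HOL-Analysis.Analysis"
begin

definition polys :: "nat \<Rightarrow> (real^'n \<Rightarrow> complex) set" where
  "polys p = {f. \<exists>c :: ('n \<Rightarrow> nat) \<Rightarrow> complex.
      f = (\<lambda>x. \<Sum>\<alpha>\<in>{\<alpha> :: 'n \<Rightarrow> nat. sum \<alpha> UNIV \<le> p}.
              c \<alpha> * (\<Prod>i\<in>UNIV. (complex_of_real (x $ i)) ^ \<alpha> i))}"

definition vpolys :: "nat \<Rightarrow> (real^'n \<Rightarrow> complex^'n) set" where
  "vpolys p = {u. \<forall>i. (\<lambda>x. u x $ i) \<in> polys p}"

text \<open>Trace on a face F (functions on F are represented as functions vanishing off F).\<close>
definition tr :: "(real^'n) set \<Rightarrow> (real^'n \<Rightarrow> complex) \<Rightarrow> (real^'n \<Rightarrow> complex)" where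
  "tr F q = (\<lambda>x. if x \<in> F then q x else 0)"

definition face_polys :: "(real^'n) set \<Rightarrow> nat \<Rightarrow> (real^'n \<Rightarrow> complex) set" where
  "face_polys F p = {\<phi>. \<exists>q\<in>polys p. \<phi> = tr F q}"

definition faces :: "(real^'n) set \<Rightarrow> (real^'n) set set" where
  "faces V = {convex hull (V - {v}) | v. v \<in> V}"

definition normal :: "(real^'n) set \<Rightarrow> (real^'n) set \<Rightarrow> real^'n" where
  "normal V F = (SOME n. norm n = 1 \<and> (\<forall>a\<in>F. \<forall>b\<in>F. n \<bullet> (a - b) = 0)
                   \<and> (\<forall>x\<in>convex hull V. \<forall>a\<in>F. n \<bullet> (x - a) \<le> 0))"

definition vol_ip :: "(real^'n) set \<Rightarrow> (real^'n \<Rightarrow> complex) \<Rightarrow> (real^'n \<Rightarrow> complex) \<Rightarrow> complex" where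
  "vol_ip K u v = integral K (\<lambda>x. u x * cnj (v x))"

definition vvol_ip :: "(real^'n) set \<Rightarrow> (real^'n \<Rightarrow> complex^'n) \<Rightarrow> (real^'n \<Rightarrow> complex^'n) \<Rightarrow> complex" where
  "vvol_ip K u v = integral K (\<lambda>x. \<Sum>i\<in>UNIV. u x $ i * cnj (v x $ i))"

text \<open>Surface integral over the (d-1)-dimensional face F with unit normal n:
  the (d-1)-dimensional Lebesgue (surface) measure on F is realised by integrating
  over the unit-height right prism F + [0,1] n the function f composed with the
  orthogonal projection onto the affine hull of F (exact by Fubini, since
  Lebesgue measure on R^d is the product of surface measure on the hyperplane
  and the 1-dimensional measure along n).\<close>
definition face_int :: "(real^'n) set \<Rightarrow> (real^'n) set \<Rightarrow> (real^'n \<Rightarrow> complex) \<Rightarrow> complex" where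
  "face_int V F f =
     (let n = normal V F; a = (SOME a. a \<in> F) in
      integral {y + t *\<^sub>R n | y t. y \<in> F \<and> t \<in> {0..1}}
        (\<lambda>x. f (x - ((x - a) \<bullet> n) *\<^sub>R n)))"

definition face_ip :: "(real^'n) set \<Rightarrow> (real^'n) set \<Rightarrow> (real^'n \<Rightarrow> complex) \<Rightarrow> (real^'n \<Rightarrow> complex) \<Rightarrow> complex" where
  "face_ip V F f g = face_int V F (\<lambda>x. f x * cnj (g x))"

definition grad :: "(real^'n \<Rightarrow> complex) \<Rightarrow> real^'n \<Rightarrow> complex^'n" where
  "grad q x = (\<chi> i. vector_derivative (\<lambda>t. q (x + t *\<^sub>R axis i 1)) (at 0))"

definition dvg :: "(real^'n \<Rightarrow> complex^'n) \<Rightarrow> real^'n \<Rightarrow> complex" where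
  "dvg v x = (\<Sum>i\<in>UNIV. vector_derivative (\<lambda>t. v (x + t *\<^sub>R axis i 1) $ i) (at 0))"

definition ncomp :: "real^'n \<Rightarrow> (real^'n \<Rightarrow> complex^'n) \<Rightarrow> real^'n \<Rightarrow> complex" where
  "ncomp n u x = (\<Sum>i\<in>UNIV. complex_of_real (n $ i) * u x $ i)"

definition good_face_op :: "(real^'n) set \<Rightarrow> (real^'n) set \<Rightarrow> nat \<Rightarrow>
    ((real^'n \<Rightarrow> complex) \<Rightarrow> (real^'n \<Rightarrow> complex)) \<Rightarrow> bool" where
  "good_face_op V F p A \<longleftrightarrow>
     (\<forall>\<phi>\<in>face_polys F p. A \<phi> \<in> face_polys F p) \<and>
     (\<forall>\<phi>\<in>face_polys F p. \<forall>\<psi>\<in>face_polys F p. A (\<lambda>x. \<phi> x + \<psi> x) = (\<lambda>x. A \<phi> x + A \<psi> x)) \<and>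
     (\<forall>\<phi>\<in>face_polys F p. \<forall>c::complex. A (\<lambda>x. c * \<phi> x) = (\<lambda>x. c * A \<phi> x)) \<and>
     (\<forall>\<phi>\<in>face_polys F p. \<forall>\<psi>\<in>face_polys F p. face_ip V F (A \<phi>) \<psi> = face_ip V F \<phi> (A \<psi>)) \<and>
     (\<forall>\<phi>\<in>face_polys F p. \<phi> \<noteq> (\<lambda>x. 0) \<longrightarrow>
         Im (face_ip V F (A \<phi>) \<phi>) = 0 \<and> Re (face_ip V F (A \<phi>) \<phi>) > 0)"

end

theory Submission
  imports Defs
begin

text \<open>
  Testing the homogeneous problem with \<open>q = p\<^sub>K\<close>, \<open>v = u\<^sub>K\<close> and adding the first equation to the
  conjugate of the second, Green's formula cancels all mixed terms. The volume terms are purely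
  imaginary, so the real part gives \<open>\<Sum>\<^sub>F \<langle>A\<^sub>F\<^sup>-\<^sup>1 p\<^sub>K, p\<^sub>K\<rangle> = 0\<close> and \<open>p\<^sub>K\<close> vanishes on the
  boundary. The equations then read \<open>\<nabla>p\<^sub>K = \<i>\<kappa>\<eta> u\<^sub>K\<close> and \<open>\<nabla>\<cdot>u\<^sub>K = \<i>\<kappa>\<eta>\<^sup>-\<^sup>1 p\<^sub>K\<close>, so \<open>p\<^sub>K\<close> is a
  multiple of its own Laplacian. Since the Laplacian lowers the degree of a polynomial, \<open>p\<^sub>K = 0\<close>
  and \<open>u\<^sub>K = 0\<close>. Existence follows because the problem is a square linear system.

  For the divergence theorem on the simplex it suffices, by linearity, to treat derivatives along
  the edges. There it reduces to the fundamental theorem of calculus on each line parallel to the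
  edge, by the principle that two functions with the same integrals over all lines of a fixed
  direction have the same integral. The same principle shows that the surface integral, defined by
  a right prism over the face, can be computed from any oblique prism.
\<close>

section \<open>Integrals from line integrals\<close>

text \<open>Since \<open>face_int\<close> is itself a volume integral over a right prism, boundary
  identities become comparisons of volume integrals over different bodies. Comparing them along
  lines in one direction \<open>e\<close> is justified by Fubini, once a volume-preserving shear has
  turned \<open>e\<close> into a coordinate direction. The value of a function where a line crosses
  a face becomes an integral over a section of the prism in direction \<open>e\<close>, of length
  one in the line parameter; the price is the factor |e . n|, which up to sign is the weight of that
  face in the divergence theorem. In the uniqueness argument the equations hold pointwise and not
  just weakly because both unknowns have the same degree bound \<open>p\<close>: the residuals
  \<open>grad f - \<mu> u\<close> and \<open>dvg u - \<nu> f\<close> are themselves admissible test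
  functions. Being polynomial identities, they extend from the simplex to the whole space, where the
  degree argument applies for every \<open>\<kappa>\<close>, without any resonance
  condition.\<close>

lemma nn_integral_lborel_slice:
  fixes f :: "'a::euclidean_space \<Rightarrow> ennreal"
  assumes f[measurable]: "f \<in> borel_measurable borel" and b: "b \<in> Basis"
  shows "(\<integral>\<^sup>+x. f x \<partial>lborel) =
    (\<integral>\<^sup>+y. (\<integral>\<^sup>+t. f ((\<Sum>c\<in>Basis - {b}. y c *\<^sub>R c) + t *\<^sub>R b) \<partial>lborel) \<partial>(\<Pi>\<^sub>M c\<in>Basis - {b}. lborel))"
proof -
  interpret product_sigma_finite "\<lambda>_::'a. lborel :: real measure"
    by standard
  have ins: "insert b (Basis - {b}) = (Basis :: 'a set)"
    using b by auto
  have "(\<integral>\<^sup>+x. f x \<partial>lborel) = (\<integral>\<^sup>+y. f (\<Sum>c\<in>Basis. y c *\<^sub>R c) \<partial>(\<Pi>\<^sub>M c\<in>Basis. lborel))"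
    by (subst lborel_eq) (simp add: nn_integral_distr)
  also have "\<dots> = (\<integral>\<^sup>+y. f (\<Sum>c\<in>Basis. y c *\<^sub>R c) \<partial>(\<Pi>\<^sub>M c\<in>insert b (Basis - {b}). lborel))"
    by (simp only: ins)
  also have "\<dots> = (\<integral>\<^sup>+y. (\<integral>\<^sup>+t. f (\<Sum>c\<in>Basis. (y(b:=t)) c *\<^sub>R c) \<partial>lborel) \<partial>(\<Pi>\<^sub>M c\<in>Basis - {b}. lborel))"
    by (subst product_nn_integral_insert) (auto simp: ins)
  also have "(\<lambda>y t. f (\<Sum>c\<in>Basis. (y(b:=t)) c *\<^sub>R c)) =
      (\<lambda>y t. f ((\<Sum>c\<in>Basis - {b}. y c *\<^sub>R c) + t *\<^sub>R b))"
    by (intro ext) (simp add: sum.remove[OF _ b] add.commute)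
  finally show ?thesis .
qed

text \<open>Vector-valued companion of the nonnegative version: the latter measures sheared sets
  without any integrability assumption, this one serves the functions whose line integrals are
  compared.\<close>

lemma integral_lborel_slice:
  fixes f :: "'a::euclidean_space \<Rightarrow> 'b::{banach, second_countable_topology}"
  assumes f: "integrable lborel f" and b: "b \<in> Basis"
  shows "(\<integral>x. f x \<partial>lborel) =
    (\<integral>y. (\<integral>t. f ((\<Sum>c\<in>Basis - {b}. y c *\<^sub>R c) + t *\<^sub>R b) \<partial>lborel) \<partial>(\<Pi>\<^sub>M c\<in>Basis - {b}. lborel))"
proof -
  interpret product_sigma_finite "\<lambda>_::'a. lborel :: real measure"
    by standard
  have ins: "insert b (Basis - {b}) = (Basis :: 'a set)"
    using b by auto
  have [measurable]: "f \<in> borel_measurable borel"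
    using f by auto
  have int: "integrable (\<Pi>\<^sub>M c\<in>Basis. lborel) (\<lambda>y. f (\<Sum>c\<in>Basis. y c *\<^sub>R c))"
    using f by (subst (asm) lborel_eq) (simp add: integrable_distr_eq)
  have "(\<integral>x. f x \<partial>lborel) = (\<integral>y. f (\<Sum>c\<in>Basis. y c *\<^sub>R c) \<partial>(\<Pi>\<^sub>M c\<in>Basis. lborel))"
    by (subst lborel_eq) (simp add: integral_distr)
  also have "\<dots> = (\<integral>y. f (\<Sum>c\<in>Basis. y c *\<^sub>R c) \<partial>(\<Pi>\<^sub>M c\<in>insert b (Basis - {b}). lborel))"
    by (simp only: ins)
  also have "\<dots> = (\<integral>y. (\<integral>t. f (\<Sum>c\<in>Basis. (y(b:=t)) c *\<^sub>R c) \<partial>lborel) \<partial>(\<Pi>\<^sub>M c\<in>Basis - {b}. lborel))"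
    by (subst product_integral_insert) (use int in \<open>auto simp: insert_absorb[OF b]\<close>)
  also have "(\<lambda>y t. f (\<Sum>c\<in>Basis. (y(b:=t)) c *\<^sub>R c)) =
      (\<lambda>y t. f ((\<Sum>c\<in>Basis - {b}. y c *\<^sub>R c) + t *\<^sub>R b))"
    by (intro ext) (simp add: sum.remove[OF _ b] add.commute)
  finally show ?thesis .
qed

text \<open>Cavalieri's principle: on a line parallel to \<open>b'\<close> the map is a translation,
  because \<open>x \<bullet> b\<close> is constant there, and one-dimensional Lebesgue measure is
  translation invariant.\<close>

lemma lborel_distr_elementary_shear:
  fixes b b' :: "'a::euclidean_space"
  assumes b: "b \<in> Basis" "b' \<in> Basis" "b \<noteq> b'"
  shows "distr lborel borel (\<lambda>x. x + (r * (x \<bullet> b)) *\<^sub>R b') = lborel"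
proof (rule measure_eqI)
  fix A assume "A \<in> sets (distr lborel borel (\<lambda>x. x + (r * (x \<bullet> b)) *\<^sub>R b'))"
  then have A[measurable]: "A \<in> sets borel" by simp
  let ?T = "\<lambda>x. x + (r * (x \<bullet> b)) *\<^sub>R b'"
  have bb: "b' \<bullet> b = 0"
    using b by (simp add: inner_Basis)
  have "emeasure (distr lborel borel ?T) A = (\<integral>\<^sup>+x. indicator A (?T x) \<partial>lborel)"
    by (subst nn_integral_indicator[symmetric], simp, subst nn_integral_distr) auto
  also have "\<dots> = (\<integral>\<^sup>+y. (\<integral>\<^sup>+t. indicator A (?T ((\<Sum>c\<in>Basis - {b'}. y c *\<^sub>R c) + t *\<^sub>R b'))
      \<partial>lborel) \<partial>(\<Pi>\<^sub>M c\<in>Basis - {b'}. lborel))"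
    by (intro nn_integral_lborel_slice) (use b in auto)
  also have "\<dots> = (\<integral>\<^sup>+y. (\<integral>\<^sup>+t. indicator A ((\<Sum>c\<in>Basis - {b'}. y c *\<^sub>R c) + t *\<^sub>R b')
      \<partial>lborel) \<partial>(\<Pi>\<^sub>M c\<in>Basis - {b'}. lborel))"
  proof (rule nn_integral_cong)
    fix y :: "'a \<Rightarrow> real"
    let ?y = "\<Sum>c\<in>Basis - {b'}. y c *\<^sub>R c"
    show "(\<integral>\<^sup>+t. indicator A (?T (?y + t *\<^sub>R b')) \<partial>lborel) =
          (\<integral>\<^sup>+t. indicator A (?y + t *\<^sub>R b') \<partial>lborel)"
      by (subst (2) nn_integral_real_affine[where c=1 and t="r * (?y \<bullet> b)"])
        (auto simp: bb inner_add_left scaleR_add_left ac_simps)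
  qed
  also have "\<dots> = (\<integral>\<^sup>+x. indicator A x \<partial>lborel)"
    by (rule nn_integral_lborel_slice[symmetric]) (use b in auto)
  finally show "emeasure (distr lborel borel ?T) A = emeasure lborel A"
    by simp
qed simp

text \<open>A shear is a composition of elementary shears, one for each coordinate of
  \<open>u\<close>. None of them changes \<open>x \<bullet> b\<close>, so the displacements simply
  add up.\<close>

lemma lborel_distr_shear:
  fixes b u :: "'a::euclidean_space"
  assumes b: "b \<in> Basis" and u: "u \<bullet> b = 0"
  shows "distr lborel borel (\<lambda>x. x + (x \<bullet> b) *\<^sub>R u) = lborel"
proof -
  have "distr lborel borel (\<lambda>x. x + (x \<bullet> b) *\<^sub>R (\<Sum>c\<in>B. (u \<bullet> c) *\<^sub>R c)) = lborel"
    if "finite B" "B \<subseteq> Basis - {b}" for B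
    using that
  proof (induction B rule: finite_induct)
    case (insert c B)
    let ?s = "\<Sum>c\<in>B. (u \<bullet> c) *\<^sub>R c"
    have s: "?s \<bullet> b = 0"
      unfolding inner_sum_left using insert.prems b
      by (intro sum.neutral ballI) (metis (no_types, lifting) Diff_iff inner_Basis inner_scaleR_left
        insertCI mult_zero_right subsetD)
    have "distr lborel borel (\<lambda>x. x + (x \<bullet> b) *\<^sub>R (\<Sum>c\<in>insert c B. (u \<bullet> c) *\<^sub>R c)) =
        distr (distr lborel borel (\<lambda>x. x + (x \<bullet> b) *\<^sub>R ?s)) borel (\<lambda>x. x + ((u \<bullet> c) * (x \<bullet> b)) *\<^sub>R c)"
      using insert.hyps s
      by (subst distr_distr) (auto simp: o_def inner_add_left algebra_simps)
    also have "\<dots> = lborel"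
      using insert b by (auto intro!: lborel_distr_elementary_shear)
    finally show ?case .
  qed (simp add: distr_id2)
  from this[of "Basis - {b}"] have "distr lborel borel (\<lambda>x. x + (x \<bullet> b) *\<^sub>R (\<Sum>c\<in>Basis - {b}. (u \<bullet> c) *\<^sub>R c)) = lborel"
    by simp
  moreover have "(\<Sum>c\<in>Basis - {b}. (u \<bullet> c) *\<^sub>R c) = u"
    using euclidean_representation[of u] u by (simp add: sum.remove[OF _ b])
  ultimately show ?thesis by simp
qed

text \<open>A volume-preserving shear carries the lines parallel to a basis vector \<open>b\<close>
  to lines parallel to \<open>e\<close>. Fubini in the direction \<open>b\<close> then integrates
  over lines parallel to \<open>e\<close>, with a factor that is the same for \<open>f\<close> and
  \<open>g\<close>.\<close>

proposition integral_eq_if_line_integrals_eq: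
  fixes f g :: "'a::euclidean_space \<Rightarrow> 'b::{banach, second_countable_topology}"
  assumes f: "integrable lborel f" and g: "integrable lborel g" and e: "e \<noteq> 0"
    and eq: "\<And>x. (\<integral>t. f (x + t *\<^sub>R e) \<partial>lborel) = (\<integral>t. g (x + t *\<^sub>R e) \<partial>lborel)"
  shows "(\<integral>x. f x \<partial>lborel) = (\<integral>x. g x \<partial>lborel)"
proof -
  obtain b where b: "b \<in> Basis" "e \<bullet> b \<noteq> 0"
    using e by (metis euclidean_all_zero_iff)
  \<comment> \<open>Chosen so that \<open>b + u\<close> is a multiple of \<open>e\<close> while
    \<open>u \<bullet> b = 0\<close>: the shear \<open>S\<close> maps the direction \<open>b\<close>
    to that of \<open>e\<close>.\<close>
  define u where "u = e /\<^sub>R (e \<bullet> b) - b"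
  define S where "S = (\<lambda>x. x + (x \<bullet> b) *\<^sub>R u)"
  have ub: "u \<bullet> b = 0"
    using b by (simp add: u_def inner_diff_left inner_Basis)
  have dS: "distr lborel borel S = lborel"
    unfolding S_def by (rule lborel_distr_shear[OF b(1) ub])
  have [measurable]: "S \<in> borel_measurable borel"
    unfolding S_def by simp
  have line: "S (x + t *\<^sub>R b) = S x + t *\<^sub>R (e /\<^sub>R (e \<bullet> b))" for x t
    using b by (simp add: S_def u_def inner_add_left inner_Basis algebra_simps)
  have slice: "(\<integral>x. h x \<partial>lborel) = (\<integral>y. \<bar>e \<bullet> b\<bar> *\<^sub>R
      (\<integral>t. h (S (\<Sum>c\<in>Basis - {b}. y c *\<^sub>R c) + t *\<^sub>R e) \<partial>lborel) \<partial>(\<Pi>\<^sub>M c\<in>Basis - {b}. lborel))"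
    if h: "integrable lborel h" for h :: "'a \<Rightarrow> 'b"
  proof -
    have [measurable]: "h \<in> borel_measurable borel"
      using h by auto
    have hS: "integrable lborel (\<lambda>x. h (S x))"
      using h by (subst (asm) dS[symmetric]) (simp add: integrable_distr_eq)
    have "(\<integral>x. h x \<partial>lborel) = (\<integral>x. h (S x) \<partial>lborel)"
      by (subst dS[symmetric]) (simp add: integral_distr)
    also have "\<dots> = (\<integral>y. (\<integral>t. h (S (\<Sum>c\<in>Basis - {b}. y c *\<^sub>R c) + t *\<^sub>R (e /\<^sub>R (e \<bullet> b))) \<partial>lborel)
        \<partial>(\<Pi>\<^sub>M c\<in>Basis - {b}. lborel))"
      by (subst integral_lborel_slice[OF hS b(1)]) (simp only: line)
    also have "\<dots> = (\<integral>y. \<bar>e \<bullet> b\<bar> *\<^sub>R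
      (\<integral>t. h (S (\<Sum>c\<in>Basis - {b}. y c *\<^sub>R c) + t *\<^sub>R e) \<partial>lborel) \<partial>(\<Pi>\<^sub>M c\<in>Basis - {b}. lborel))"
    proof (rule Bochner_Integration.integral_cong[OF refl])
      fix y :: "'a \<Rightarrow> real"
      show "(\<integral>t. h (S (\<Sum>c\<in>Basis - {b}. y c *\<^sub>R c) + t *\<^sub>R (e /\<^sub>R (e \<bullet> b))) \<partial>lborel) =
          \<bar>e \<bullet> b\<bar> *\<^sub>R (\<integral>t. h (S (\<Sum>c\<in>Basis - {b}. y c *\<^sub>R c) + t *\<^sub>R e) \<partial>lborel)"
        by (subst lborel_integral_real_affine[where c="e \<bullet> b" and t=0])
          (use b in \<open>auto simp: field_simps\<close>)
    qed
    finally show ?thesis .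
  qed
  show ?thesis
    by (simp add: slice[OF f] slice[OF g] eq)
qed

section \<open>Integrals over compact sets and their line sections\<close>

lemma
  fixes f :: "'a::euclidean_space \<Rightarrow> 'b::euclidean_space"
  assumes "compact S" "continuous_on S f"
  shows integrable_on_compact: "f integrable_on S"
    and integral_compact_eq_lborel: "integral S f = (\<integral>x. indicator S x *\<^sub>R f x \<partial>lborel)"
proof -
  have "set_integrable lborel S f"
    unfolding set_integrable_def by (rule borel_integrable_compact[OF assms])
  from set_borel_integral_eq_integral[OF this]
  show "f integrable_on S" "integral S f = (\<integral>x. indicator S x *\<^sub>R f x \<partial>lborel)"
    by (simp_all add: set_lebesgue_integral_def)
qed

lemma compact_line_section:
  fixes S :: "'a::real_normed_vector set"
  assumes "compact S" "e \<noteq> 0"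
  shows "compact {t. x + t *\<^sub>R e \<in> S}"
proof -
  obtain B where B: "\<And>y. y \<in> S \<Longrightarrow> norm y \<le> B"
    using compact_imp_bounded[OF assms(1)] by (auto simp: bounded_iff)
  have "\<bar>t\<bar> \<le> (B + norm x) / norm e" if "x + t *\<^sub>R e \<in> S" for t
  proof -
    have "norm (t *\<^sub>R e) \<le> norm (x + t *\<^sub>R e) + norm x"
      by (metis add_diff_cancel_left' norm_triangle_ineq4)
    with B[OF that] have "\<bar>t\<bar> * norm e \<le> B + norm x" by simp
    then show ?thesis
      using assms(2) by (simp add: field_simps)
  qed
  then have "bounded {t. x + t *\<^sub>R e \<in> S}"
    unfolding bounded_iff by auto
  moreover have "closed ((\<lambda>t. x + t *\<^sub>R e) -` S)"
    using assms by (intro closed_vimage compact_imp_closed continuous_intros)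
  ultimately show ?thesis
    by (simp add: compact_eq_bounded_closed vimage_def)
qed

text \<open>The difference on the right is dictated by the fundamental theorem of calculus on a
  line: a derivative integrates to a difference of two endpoint values, each of which will be an
  integral over the section of a prism.\<close>

corollary integral_compact_eq_if_line_integrals_eq:
  fixes f g h :: "'a::euclidean_space \<Rightarrow> 'b::euclidean_space"
  assumes S: "compact S" "continuous_on S f" and T: "compact T" "continuous_on T g"
    and R: "compact R" "continuous_on R h" and e: "e \<noteq> 0"
    and eq: "\<And>x. integral {t. x + t *\<^sub>R e \<in> S} (\<lambda>t. f (x + t *\<^sub>R e)) =
      integral {t. x + t *\<^sub>R e \<in> T} (\<lambda>t. g (x + t *\<^sub>R e)) -
      integral {t. x + t *\<^sub>R e \<in> R} (\<lambda>t. h (x + t *\<^sub>R e))"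
  shows "integral S f = integral T g - integral R h"
proof -
  have line: "integral {t. x + t *\<^sub>R e \<in> S} (\<lambda>t. f (x + t *\<^sub>R e)) =
      (\<integral>t. indicator S (x + t *\<^sub>R e) *\<^sub>R f (x + t *\<^sub>R e) \<partial>lborel)"
    "integrable lborel (\<lambda>t. indicator S (x + t *\<^sub>R e) *\<^sub>R f (x + t *\<^sub>R e))"
    if "compact S" "continuous_on S f" for S and f :: "'a \<Rightarrow> 'b" and x
  proof -
    have c: "compact {t. x + t *\<^sub>R e \<in> S}"
      using compact_line_section that(1) e by blast
    have d: "continuous_on {t. x + t *\<^sub>R e \<in> S} (\<lambda>t. f (x + t *\<^sub>R e))"
      by (rule continuous_on_compose2[OF that(2)]) (auto intro!: continuous_intros)
    have i: "indicator {t. x + t *\<^sub>R e \<in> S} = (\<lambda>t. indicator S (x + t *\<^sub>R e) :: real)"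
      by (auto simp: indicator_def)
    show "integral {t. x + t *\<^sub>R e \<in> S} (\<lambda>t. f (x + t *\<^sub>R e)) =
      (\<integral>t. indicator S (x + t *\<^sub>R e) *\<^sub>R f (x + t *\<^sub>R e) \<partial>lborel)"
      "integrable lborel (\<lambda>t. indicator S (x + t *\<^sub>R e) *\<^sub>R f (x + t *\<^sub>R e))"
      using integral_compact_eq_lborel[OF c d] borel_integrable_compact[OF c d] by (simp_all add: i)
  qed
  have int: "integrable lborel (\<lambda>x. indicator T x *\<^sub>R g x)" "integrable lborel (\<lambda>x. indicator R x *\<^sub>R h x)"
    using T R by (simp_all add: borel_integrable_compact)
  have "integral S f = (\<integral>x. indicator S x *\<^sub>R f x \<partial>lborel)"
    by (rule integral_compact_eq_lborel[OF S])
  also have "\<dots> = (\<integral>x. indicator T x *\<^sub>R g x - indicator R x *\<^sub>R h x \<partial>lborel)"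
  proof (rule integral_eq_if_line_integrals_eq[OF _ _ e])
    show "integrable lborel (\<lambda>x. indicator S x *\<^sub>R f x)"
      by (rule borel_integrable_compact[OF S])
    show "integrable lborel (\<lambda>x. indicator T x *\<^sub>R g x - indicator R x *\<^sub>R h x)"
      using int by simp
    show "(\<integral>t. indicator S (x + t *\<^sub>R e) *\<^sub>R f (x + t *\<^sub>R e) \<partial>lborel) =
      (\<integral>t. indicator T (x + t *\<^sub>R e) *\<^sub>R g (x + t *\<^sub>R e) - indicator R (x + t *\<^sub>R e) *\<^sub>R h (x + t *\<^sub>R e) \<partial>lborel)" for x
      using eq[of x] line[OF S] line[OF T] line[OF R] by (simp add: Bochner_Integration.integral_diff)
  qed
  also have "\<dots> = integral T g - integral R h"
    using int by (simp add: integral_compact_eq_lborel[OF T] integral_compact_eq_lborel[OF R])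
  finally show ?thesis .
qed

section \<open>The divergence theorem on a simplex\<close>

text \<open>The right prism of the surface integral is the case where \<open>e\<close> is the unit
  normal. In general \<open>t\<close> counts multiples of \<open>e\<close>, so the height over the
  plane of \<open>F\<close> is |e . n|.\<close>

definition prism :: "'a::real_vector set \<Rightarrow> 'a \<Rightarrow> 'a set" where
  "prism F e = {y + t *\<^sub>R e | y t. y \<in> F \<and> t \<in> {0..1}}"

text \<open>Together with \<open>oblique_proj\<close> this recovers \<open>t\<close> and
  \<open>y\<close> from the point \<open>y + t e\<close>, for \<open>y\<close> in the hyperplane
  through \<open>a\<close> with normal \<open>n\<close> and \<open>e\<close> transversal to
  it.\<close>

definition oblique_height :: "'a::real_inner \<Rightarrow> 'a \<Rightarrow> 'a \<Rightarrow> 'a \<Rightarrow> real" where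
  "oblique_height n a e x = ((x - a) \<bullet> n) / (e \<bullet> n)"

definition oblique_proj :: "'a::real_inner \<Rightarrow> 'a \<Rightarrow> 'a \<Rightarrow> 'a \<Rightarrow> 'a" where
  "oblique_proj n a e x = x - oblique_height n a e x *\<^sub>R e"

lemma compact_prism:
  fixes F :: "'a::real_normed_vector set"
  assumes "compact F"
  shows "compact (prism F e)"
proof -
  have "prism F e = (\<lambda>(y, t). y + t *\<^sub>R e) ` (F \<times> {0..1})"
    by (force simp: prism_def)
  then show ?thesis
    using assms by (auto intro!: compact_continuous_image compact_Times continuous_intros
        simp: case_prod_unfold)
qed

lemma oblique_height_prism:
  assumes "e \<bullet> n \<noteq> 0" "(y - a) \<bullet> n = 0"
  shows "oblique_height n a e (y + t *\<^sub>R e) = t"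
proof -
  have "(y + t *\<^sub>R e - a) \<bullet> n = (y - a) \<bullet> n + t * (e \<bullet> n)"
    by (simp add: inner_diff_left inner_add_left)
  then show ?thesis using assms by (simp add: oblique_height_def)
qed

lemma oblique_proj_prism:
  assumes "e \<bullet> n \<noteq> 0" "(y - a) \<bullet> n = 0"
  shows "oblique_proj n a e (y + t *\<^sub>R e) = y"
  using oblique_height_prism[OF assms] by (simp add: oblique_proj_def)

lemma mem_prism_iff:
  assumes "e \<bullet> n \<noteq> 0" "\<And>y. y \<in> F \<Longrightarrow> (y - a) \<bullet> n = 0"
  shows "x \<in> prism F e \<longleftrightarrow> oblique_height n a e x \<in> {0..1} \<and> oblique_proj n a e x \<in> F"
proof
  assume "x \<in> prism F e"
  then obtain y t where "x = y + t *\<^sub>R e" "y \<in> F" "t \<in> {0..1}"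
    by (auto simp: prism_def)
  then show "oblique_height n a e x \<in> {0..1} \<and> oblique_proj n a e x \<in> F"
    using assms by (simp add: oblique_height_prism oblique_proj_prism)
next
  assume "oblique_height n a e x \<in> {0..1} \<and> oblique_proj n a e x \<in> F"
  moreover have "x = oblique_proj n a e x + oblique_height n a e x *\<^sub>R e"
    by (simp add: oblique_proj_def)
  ultimately show "x \<in> prism F e"
    unfolding prism_def by blast
qed

lemma continuous_on_oblique_proj:
  fixes n :: "'a::real_inner"
  shows "continuous_on S (oblique_proj n a e)"
  unfolding oblique_proj_def oblique_height_def divide_inverse
  by (intro continuous_intros)

lemma continuous_on_prism:
  fixes n :: "'a::real_inner"
  assumes "e \<bullet> n \<noteq> 0" "\<And>y. y \<in> F \<Longrightarrow> (y - a) \<bullet> n = 0" and f: "continuous_on F f"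
  shows "continuous_on (prism F e) (\<lambda>x. f (oblique_proj n a e x))"
  by (intro continuous_on_compose2[OF f continuous_on_oblique_proj])
    (use mem_prism_iff[of e n F a, OF assms(1,2)] in auto)

text \<open>Passes from \<open>e\<close> to \<open>n\<close> by two comparisons of line integrals:
  along the tangential part of \<open>e\<close>, where points at equal height are merely translated,
  and along \<open>n\<close>, where heights are rescaled by \<open>e \<bullet> n\<close>.\<close>

lemma integral_oblique_prism:
  fixes f :: "'a::euclidean_space \<Rightarrow> complex"
  assumes F: "compact F" and n: "n \<bullet> n = 1" and e: "e \<bullet> n \<noteq> 0"
    and Fn: "\<And>y. y \<in> F \<Longrightarrow> (y - a) \<bullet> n = 0" and f: "continuous_on F f"
  shows "integral (prism F e) (\<lambda>x. f (oblique_proj n a e x)) =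
    \<bar>e \<bullet> n\<bar> *\<^sub>R integral (prism F n) (\<lambda>x. f (oblique_proj n a n x))"
proof -
  define c where "c = e \<bullet> n"
  define u where "u = e - c *\<^sub>R n"
  \<comment> \<open>\<open>\<phi>\<close> depends on height and foot point only and has both
    indicators built in, so that all prisms share one integrand defined on the whole space.\<close>
  define \<phi> where "\<phi> = (\<lambda>s y. indicator {0..1::real} s *\<^sub>R (indicator F y *\<^sub>R f y))"
  define G where "G = (\<lambda>e x. \<phi> (oblique_height n a e x) (oblique_proj n a e x))"
  have c: "c \<noteq> 0" using e by (simp add: c_def)
  have un: "u \<bullet> n = 0"
    using n by (simp add: u_def c_def inner_diff_left)
  have G: "integral (prism F e') (\<lambda>x. f (oblique_proj n a e' x)) = (\<integral>x. G e' x \<partial>lborel)"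
    "integrable lborel (G e')" if "e' \<bullet> n \<noteq> 0" for e'
  proof -
    have "indicator (prism F e') x *\<^sub>R f (oblique_proj n a e' x) = G e' x" for x
      using mem_prism_iff[of e' n F a, OF that Fn]
      by (simp add: G_def \<phi>_def indicator_def)
    then show "integral (prism F e') (\<lambda>x. f (oblique_proj n a e' x)) = (\<integral>x. G e' x \<partial>lborel)"
      "integrable lborel (G e')"
      using integral_compact_eq_lborel[OF compact_prism[OF F] continuous_on_prism[OF that Fn f]]
        borel_integrable_compact[OF compact_prism[OF F] continuous_on_prism[OF that Fn f]]
      by auto
  qed
  have cn: "(c *\<^sub>R n) \<bullet> n \<noteq> 0" and nn: "n \<bullet> n \<noteq> 0"
    using n c by simp_all
  have "(\<integral>x. G e x \<partial>lborel) = (\<integral>x. G (c *\<^sub>R n) x \<partial>lborel)"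
  proof (cases "u = 0")
    case False
    show ?thesis
    proof (rule integral_eq_if_line_integrals_eq[OF G(2)[OF e] G(2)[OF cn] False])
      fix x
      define h where "h = oblique_height n a e x"
      have h: "oblique_height n a e (x + s *\<^sub>R u) = h" "oblique_height n a (c *\<^sub>R n) (x + s *\<^sub>R u) = h" for s
        using un n by (simp_all add: h_def oblique_height_def c_def inner_add_left inner_diff_left)
      \<comment> \<open>At height \<open>h\<close> the foot points of the two prisms agree after a
        displacement by \<open>h\<close> times \<open>u\<close>. The factor \<open>1 * s\<close>
        gives the translation the form of an affine substitution.\<close>
      have "G (c *\<^sub>R n) (x + s *\<^sub>R u) = G e (x + (h + 1 * s) *\<^sub>R u)" for s
        unfolding G_def oblique_proj_def h by (simp add: u_def algebra_simps)
      then show "(\<integral>s. G e (x + s *\<^sub>R u) \<partial>lborel) = (\<integral>s. G (c *\<^sub>R n) (x + s *\<^sub>R u) \<partial>lborel)"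
        by (subst lborel_integral_real_affine[where c=1 and t=h]) auto
    qed
  qed (simp add: u_def)
  also have "\<dots> = (\<integral>x. \<bar>c\<bar> *\<^sub>R G n x \<partial>lborel)"
  proof (rule integral_eq_if_line_integrals_eq[OF G(2)[OF cn]])
    show "integrable lborel (\<lambda>x. \<bar>c\<bar> *\<^sub>R G n x)"
      using G(2)[OF nn] by simp
    show "n \<noteq> 0" using n by auto
    fix x
    define h where "h = (x - a) \<bullet> n"
    define y where "y = x - h *\<^sub>R n"
    have 1: "G n (x + t *\<^sub>R n) = \<phi> (h + 1 * t) y" for t
      using n by (simp add: G_def oblique_height_def oblique_proj_def h_def y_def inner_add_left inner_diff_left algebra_simps)
    have 2: "G (c *\<^sub>R n) (x + (- h + c * t) *\<^sub>R n) = \<phi> t y" for t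
      using n c by (simp add: G_def oblique_height_def oblique_proj_def h_def y_def inner_add_left inner_diff_left algebra_simps)
    have "(\<integral>t. G (c *\<^sub>R n) (x + t *\<^sub>R n) \<partial>lborel) = \<bar>c\<bar> *\<^sub>R (\<integral>t. \<phi> t y \<partial>lborel)"
      by (subst lborel_integral_real_affine[where c=c and t="-h", OF c]) (simp only: 2)
    also have "\<dots> = \<bar>c\<bar> *\<^sub>R (\<integral>t. G n (x + t *\<^sub>R n) \<partial>lborel)"
      by (subst lborel_integral_real_affine[where c=1 and t=h]) (simp_all add: 1)
    finally show "(\<integral>t. G (c *\<^sub>R n) (x + t *\<^sub>R n) \<partial>lborel) = (\<integral>t. \<bar>c\<bar> *\<^sub>R G n (x + t *\<^sub>R n) \<partial>lborel)"
      by simp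
  qed
  also have "\<dots> = \<bar>c\<bar> *\<^sub>R (\<integral>x. G n x \<partial>lborel)"
    by simp
  finally show ?thesis
    by (simp add: G(1)[OF e] G(1)[OF nn] c_def)
qed

section \<open>Barycentric coordinates, faces and normals of a simplex\<close>

locale full_simplex =
  fixes V :: "(real^'n) set"
  assumes finite_V: "finite V" and card_V: "card V = CARD('n) + 1"
    and indep_V: "\<not> affine_dependent V"
begin

text \<open>Meant for every point of the space, since lines have to be followed outside the simplex
  too. Only the values on \<open>V\<close> are determined.\<close>

definition bary :: "real^'n \<Rightarrow> real^'n \<Rightarrow> real" where
  "bary x = (SOME u. sum u V = 1 \<and> (\<Sum>v\<in>V. u v *\<^sub>R v) = x)"

abbreviation face :: "real^'n \<Rightarrow> (real^'n) set" where
  "face k \<equiv> convex hull (V - {k})"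

lemma affine_hull_V: "affine hull V = UNIV"
  using affine_independent_span_eq[OF indep_V] card_V by simp

lemma bary: "sum (bary x) V = 1" "(\<Sum>v\<in>V. bary x v *\<^sub>R v) = x"
proof -
  have "\<exists>u. sum u V = 1 \<and> (\<Sum>v\<in>V. u v *\<^sub>R v) = x"
    using affine_hull_V affine_hull_finite[OF finite_V] by (auto simp: set_eq_iff)
  from someI_ex[OF this] show "sum (bary x) V = 1" "(\<Sum>v\<in>V. bary x v *\<^sub>R v) = x"
    by (simp_all add: bary_def)
qed

lemma bary_unique:
  assumes "sum u V = 1" "(\<Sum>v\<in>V. u v *\<^sub>R v) = x" "v \<in> V"
  shows "bary x v = u v"
proof (rule ccontr)
  assume "bary x v \<noteq> u v"
  then have "affine_dependent V"
    unfolding affine_dependent_explicit_finite[OF finite_V]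
    by (intro exI[of _ "\<lambda>v. bary x v - u v"])
      (use assms bary[of x] in \<open>auto simp: sum_subtractf scaleR_diff_left\<close>)
  with indep_V show False by simp
qed

lemma bary_edge:
  assumes "j \<in> V" "k \<in> V" "v \<in> V"
  shows "bary (x + t *\<^sub>R (j - k)) v = bary x v + t * ((if v = j then 1 else 0) - (if v = k then 1 else 0))"
  by (rule bary_unique[OF _ _ assms(3)])
    (use assms finite_V bary[of x] in \<open>simp_all add: sum.distrib sum_subtractf scaleR_add_left
      right_diff_distrib scaleR_diff_left scaleR_diff_right if_distrib[of "\<lambda>c. _ * c"]
      if_distrib[of "\<lambda>c. c *\<^sub>R _"] cong: if_cong\<close>)

lemma mem_hull_iff: "x \<in> convex hull V \<longleftrightarrow> (\<forall>v\<in>V. 0 \<le> bary x v)"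
proof
  assume "x \<in> convex hull V"
  then obtain u where u: "\<And>v. v \<in> V \<Longrightarrow> 0 \<le> u v" "sum u V = 1" "(\<Sum>v\<in>V. u v *\<^sub>R v) = x"
    by (auto simp: convex_hull_finite[OF finite_V])
  show "\<forall>v\<in>V. 0 \<le> bary x v"
    using u(1) bary_unique[OF u(2,3)] by simp
next
  assume "\<forall>v\<in>V. 0 \<le> bary x v"
  then show "x \<in> convex hull V"
    unfolding convex_hull_finite[OF finite_V] using bary[of x] by blast
qed

lemma mem_face_iff:
  assumes k: "k \<in> V"
  shows "x \<in> face k \<longleftrightarrow> (\<forall>v\<in>V. 0 \<le> bary x v) \<and> bary x k = 0"
proof
  assume "x \<in> face k"
  then obtain u where u: "\<And>v. v \<in> V - {k} \<Longrightarrow> 0 \<le> u v" "sum u (V - {k}) = 1" "(\<Sum>v\<in>V - {k}. u v *\<^sub>R v) = x"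
    using finite_V by (auto simp: convex_hull_finite)
  define w where "w = u(k := 0)"
  have [simp]: "w k = 0" and w: "\<And>v. v \<in> V - {k} \<Longrightarrow> w v = u v"
    by (auto simp: w_def)
  have "sum w V = 1" "(\<Sum>v\<in>V. w v *\<^sub>R v) = x"
    using u(2,3) w by (simp_all add: sum.remove[OF finite_V k])
  then have "bary x v = w v" if "v \<in> V" for v
    using bary_unique that by blast
  then show "(\<forall>v\<in>V. 0 \<le> bary x v) \<and> bary x k = 0"
    using u(1) k by (simp add: w_def)
next
  assume *: "(\<forall>v\<in>V. 0 \<le> bary x v) \<and> bary x k = 0"
  then have "sum (bary x) (V - {k}) = 1" "(\<Sum>v\<in>V - {k}. bary x v *\<^sub>R v) = x"
    using bary[of x] by (simp_all add: sum.remove[OF finite_V k])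
  with * show "x \<in> face k"
    using finite_V by (auto simp: convex_hull_finite)
qed

lemma face_nonempty: "k \<in> V \<Longrightarrow> face k \<noteq> {}"
proof -
  assume "k \<in> V"
  then have "card (V - {k}) = CARD('n)"
    using card_V finite_V by simp
  then show ?thesis by (metis card.empty convex_hull_eq_empty zero_less_card_finite less_irrefl)
qed

lemma compact_hull: "compact (convex hull V)" and compact_face: "compact (face k)"
  using finite_V by (simp_all add: finite_imp_compact_convex_hull)

text \<open>As a function of \<open>x\<close>, the left side is affine and vanishes at every vertex
  except \<open>k\<close>; hence it is a multiple of the barycentric coordinate of
  \<open>k\<close>.\<close>

lemma inner_minus_face:
  assumes k: "k \<in> V" and a: "a \<in> face k" and n: "\<And>a b. a \<in> face k \<Longrightarrow> b \<in> face k \<Longrightarrow> n \<bullet> (a - b) = 0"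
  shows "n \<bullet> (x - a) = bary x k * (n \<bullet> (k - a))"
proof -
  have "x - a = (\<Sum>v\<in>V. bary x v *\<^sub>R (v - a))"
    using bary[of x] by (simp add: scaleR_diff_right sum_subtractf flip: scaleR_sum_left)
  then have "n \<bullet> (x - a) = (\<Sum>v\<in>V. bary x v * (n \<bullet> (v - a)))"
    by (simp add: inner_sum_right)
  also have "\<dots> = bary x k * (n \<bullet> (k - a)) + (\<Sum>v\<in>V - {k}. bary x v * (n \<bullet> (v - a)))"
    by (simp add: sum.remove[OF finite_V k])
  also have "(\<Sum>v\<in>V - {k}. bary x v * (n \<bullet> (v - a))) = 0"
    using n[OF _ a] by (intro sum.neutral ballI) (simp add: hull_inc)
  finally show ?thesis by simp
qed

text \<open>Otherwise \<open>n\<close> would be orthogonal to \<open>x - a\<close> for every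
  \<open>x\<close>, which \<open>x = a + n\<close> refutes.\<close>

lemma inner_vertex_nonzero:
  assumes k: "k \<in> V" and a: "a \<in> face k" and n: "\<And>a b. a \<in> face k \<Longrightarrow> b \<in> face k \<Longrightarrow> n \<bullet> (a - b) = 0"
    and n0: "n \<noteq> 0"
  shows "n \<bullet> (k - a) \<noteq> 0"
proof
  assume "n \<bullet> (k - a) = 0"
  then have "n \<bullet> ((a + n) - a) = 0"
    using inner_minus_face[OF k a n, of "a + n"] by simp
  with n0 show False by simp
qed

text \<open>The normal is given by choice, so a vector with the defining properties has to be
  exhibited. The definition asks only for a weak inequality; strictness comes from
  \<open>inner_vertex_nonzero\<close>.\<close>

lemma normal:
  assumes k: "k \<in> V"
  shows norm_normal: "norm (normal V (face k)) = 1"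
    and normal_orth: "\<And>a b. a \<in> face k \<Longrightarrow> b \<in> face k \<Longrightarrow> normal V (face k) \<bullet> (a - b) = 0"
    and normal_outward: "\<And>a. a \<in> face k \<Longrightarrow> normal V (face k) \<bullet> (k - a) < 0"
proof -
  obtain a where a: "a \<in> V - {k}"
    using face_nonempty[OF k] by auto
  \<comment> \<open>The edge vectors of the face at \<open>a\<close> number one less than the
    dimension, so some nonzero \<open>m\<close> is orthogonal to all of them.\<close>
  let ?T = "(\<lambda>v. v - a) ` (V - {k, a})"
  have "dim ?T \<le> card ?T"
    using finite_V by (intro dim_le_card') auto
  also have "\<dots> \<le> card (V - {k, a})"
    using finite_V by (intro card_image_le) auto
  also have "\<dots> < CARD('n)"
    using a k card_V finite_V by (subst card_Diff_subset) auto
  finally obtain m where m: "m \<noteq> 0" "\<And>y. y \<in> span ?T \<Longrightarrow> orthogonal m y"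
    using orthogonal_to_subspace_exists[of ?T] by auto
  have mv: "m \<bullet> (v - a) = 0" if "v \<in> V - {k}" for v
  proof (cases "v = a")
    case False
    then have "v - a \<in> span ?T"
      using that by (intro span_base) auto
    then show ?thesis using m(2) by (simp add: orthogonal_def)
  qed simp
  have "face k \<subseteq> {y. m \<bullet> y = m \<bullet> a}"
    by (rule hull_minimal) (use mv in \<open>auto simp: inner_diff_right convex_hyperplane\<close>)
  then have "m \<bullet> y = m \<bullet> a" if "y \<in> face k" for y
    using that by blast
  then have mF: "m \<bullet> (y - z) = 0" if "y \<in> face k" "z \<in> face k" for y z
    using that by (simp add: inner_diff_right)
  have aF: "a \<in> face k"
    using a by (simp add: hull_inc)
  have mk: "m \<bullet> (k - a) \<noteq> 0"
    by (rule inner_vertex_nonzero[OF k aF mF m(1)])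
  \<comment> \<open>The sign turns \<open>n\<close> away from \<open>k\<close>:
    \<open>n \<bullet> (k - a)\<close> becomes minus the absolute value of
    \<open>m \<bullet> (k - a)\<close>, divided by \<open>norm m\<close>.\<close>
  define n where "n = (- sgn (m \<bullet> (k - a)) / norm m) *\<^sub>R m"
  have n1: "norm n = 1"
    using m(1) mk by (simp add: n_def)
  have nF: "n \<bullet> (y - z) = 0" if "y \<in> face k" "z \<in> face k" for y z
    using mF[OF that] by (simp add: n_def)
  have nk: "n \<bullet> (k - a) \<le> 0"
    using m(1) mk by (simp add: n_def sgn_if divide_simps)
  have "n \<bullet> (x - b) \<le> 0" if "x \<in> convex hull V" "b \<in> face k" for x b
  proof -
    have "n \<bullet> (x - a) \<le> 0"
      using inner_minus_face[OF k aF nF, of x] nk that(1) k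
      by (simp add: mem_hull_iff mult_nonneg_nonpos)
    moreover have "n \<bullet> (x - b) = n \<bullet> (x - a) + n \<bullet> (a - b)"
      by (simp add: inner_diff_right)
    ultimately show ?thesis using nF[OF aF that(2)] by simp
  qed
  with n1 nF have "\<exists>n. norm n = 1 \<and> (\<forall>a\<in>face k. \<forall>b\<in>face k. n \<bullet> (a - b) = 0)
                   \<and> (\<forall>x\<in>convex hull V. \<forall>a\<in>face k. n \<bullet> (x - a) \<le> 0)"
    by blast
  from someI_ex[OF this, folded normal_def]
  have N: "norm (normal V (face k)) = 1"
    "\<And>a b. a \<in> face k \<Longrightarrow> b \<in> face k \<Longrightarrow> normal V (face k) \<bullet> (a - b) = 0"
    "\<And>x a. x \<in> convex hull V \<Longrightarrow> a \<in> face k \<Longrightarrow> normal V (face k) \<bullet> (x - a) \<le> 0"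
    by blast+
  show "norm (normal V (face k)) = 1" by (rule N(1))
  show "normal V (face k) \<bullet> (a - b) = 0" if "a \<in> face k" "b \<in> face k" for a b
    using N(2) that by blast
  show "normal V (face k) \<bullet> (k - a) < 0" if "a \<in> face k" for a
  proof -
    have "normal V (face k) \<noteq> 0" using N(1) by auto
    then have "normal V (face k) \<bullet> (k - a) \<noteq> 0"
      using inner_vertex_nonzero[OF k that N(2)] by blast
    moreover have "normal V (face k) \<bullet> (k - a) \<le> 0"
      using N(3)[OF _ that] k by (simp add: hull_inc)
    ultimately show ?thesis by simp
  qed
qed

lemma faces_eq: "faces V = face ` V"
  by (auto simp: faces_def)

lemma inj_on_face: "inj_on face V"
proof (rule inj_onI, rule ccontr)
  fix j k assume jk: "j \<in> V" "k \<in> V" "face j = face k" "j \<noteq> k"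
  have "k \<in> face j" using jk(2,4) by (simp add: hull_inc)
  then have "k \<in> face k" by (simp only: jk(3))
  moreover have "bary k k = (if k = k then 1 else 0)"
    by (rule bary_unique[of "\<lambda>v. if v = k then 1 else 0"])
      (use jk finite_V in \<open>simp_all add: if_distrib[of "\<lambda>c. c *\<^sub>R _"] cong: if_cong\<close>)
  ultimately show False
    using mem_face_iff jk by simp
qed

lemma sum_faces: "(\<Sum>F\<in>faces V. g F) = (\<Sum>k\<in>V. g (face k))"
  unfolding faces_eq by (simp add: sum.reindex[OF inj_on_face])

text \<open>Lets a surface integral be computed with a prism in an edge direction. The base point
  \<open>a\<close> is free although \<open>face_int\<close> fixes one by choice, because the
  projection along the normal is the same for all points of the face.\<close>

lemma face_int_oblique:
  assumes k: "k \<in> V" and a: "a \<in> face k" and e: "e \<bullet> normal V (face k) \<noteq> 0"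
    and f: "continuous_on (face k) f"
  shows "integral (prism (face k) e) (\<lambda>x. f (oblique_proj (normal V (face k)) a e x)) =
    \<bar>e \<bullet> normal V (face k)\<bar> *\<^sub>R face_int V (face k) f"
proof -
  let ?n = "normal V (face k)"
  define a' where "a' = (SOME a. a \<in> face k)"
  have a': "a' \<in> face k"
    using a unfolding a'_def by (rule someI)
  have nn: "?n \<bullet> ?n = 1"
    using norm_normal[OF k] by (simp add: norm_eq_1)
  have orth: "(y - b) \<bullet> ?n = 0" if "y \<in> face k" "b \<in> face k" for y b
    using normal_orth[OF k that] by (simp add: inner_commute)
  have "oblique_proj ?n a' ?n = oblique_proj ?n a ?n"
    using orth[OF a' a] by (auto simp: oblique_proj_def oblique_height_def inner_diff_left)
  moreover have "face_int V (face k) f = integral (prism (face k) ?n) (\<lambda>x. f (oblique_proj ?n a' ?n x))"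
    by (simp add: face_int_def Let_def a'_def prism_def oblique_proj_def oblique_height_def nn)
  ultimately show ?thesis
    using integral_oblique_prism[OF compact_face nn e orth[OF _ a] f] by simp
qed

text \<open>Turns point evaluation into a line integral: a line that meets the face at the single
  parameter \<open>t0\<close> meets the prism in \<open>{t0..t0 + 1}\<close>, an interval of length
  one on which the integrand is constant.\<close>

lemma integral_prism_line_section:
  fixes f :: "real^'n \<Rightarrow> complex"
  assumes k: "k \<in> V" and a: "a \<in> face k" and e: "e \<bullet> normal V (face k) \<noteq> 0"
    and sec: "\<And>t. x + t *\<^sub>R e \<in> face k \<longleftrightarrow> P \<and> t = t0"
  shows "integral {t. x + t *\<^sub>R e \<in> prism (face k) e}
      (\<lambda>t. f (oblique_proj (normal V (face k)) a e (x + t *\<^sub>R e))) =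
    (if P then f (x + t0 *\<^sub>R e) else 0)"
proof (cases P)
  case True
  let ?n = "normal V (face k)"
  have mem: "x + t *\<^sub>R e \<in> prism (face k) e \<longleftrightarrow> t \<in> {t0..t0 + 1}" for t
  proof
    assume "x + t *\<^sub>R e \<in> prism (face k) e"
    then obtain y s where y: "x + t *\<^sub>R e = y + s *\<^sub>R e" "y \<in> face k" "s \<in> {0..1}"
      by (auto simp: prism_def)
    then have "x + (t - s) *\<^sub>R e \<in> face k"
      by (simp add: scaleR_diff_left add_diff_eq)
    with sec y(3) show "t \<in> {t0..t0 + 1}" by auto
  next
    assume "t \<in> {t0..t0 + 1}"
    moreover have "x + t *\<^sub>R e = (x + t0 *\<^sub>R e) + (t - t0) *\<^sub>R e"
      by (simp add: scaleR_diff_left)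
    ultimately show "x + t *\<^sub>R e \<in> prism (face k) e"
      using sec True unfolding prism_def by (smt (verit) atLeastAtMost_iff mem_Collect_eq)
  qed
  have proj: "oblique_proj ?n a e (x + t *\<^sub>R e) = x + t0 *\<^sub>R e" for t
  proof -
    have "(x + t0 *\<^sub>R e - a) \<bullet> ?n = 0"
      using normal_orth[OF k _ a] sec True by (simp add: inner_commute)
    from oblique_proj_prism[OF e this, of "t - t0"] show ?thesis
      by (simp add: scaleR_diff_left)
  qed
  show ?thesis
    using True by (simp only: mem proj Collect_mem_eq integral_const_real) simp
next
  case False
  have "x + t *\<^sub>R e \<notin> prism (face k) e" for t
  proof
    assume "x + t *\<^sub>R e \<in> prism (face k) e"
    then obtain y s where y: "x + t *\<^sub>R e = y + s *\<^sub>R e" "y \<in> face k"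
      by (auto simp: prism_def)
    then have "x + (t - s) *\<^sub>R e \<in> face k"
      by (simp add: scaleR_diff_left add_diff_eq)
    with sec False show False by simp
  qed
  with False show ?thesis by simp
qed

text \<open>A line parallel to the edge from \<open>k\<close> to \<open>j\<close> enters the simplex through the face opposite \<open>j\<close> and
  leaves it through the face opposite \<open>k\<close>; all other faces are parallel to the edge.\<close>

lemma divergence_theorem_edge:
  fixes f :: "real^'n \<Rightarrow> complex"
  assumes j: "j \<in> V" and k: "k \<in> V" and jk: "j \<noteq> k"
    and f: "\<And>x. (f has_derivative D x) (at x)"
    and D: "continuous_on UNIV (\<lambda>x. D x (j - k))"
  shows "integral (convex hull V) (\<lambda>x. D x (j - k)) =
    (\<Sum>v\<in>V. (normal V (face v) \<bullet> (j - k)) *\<^sub>R face_int V (face v) f)"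
proof -
  define e where "e = j - k"
  have e0: "e \<noteq> 0" using jk by (simp add: e_def)
  obtain a b where a: "a \<in> face k" and b: "b \<in> face j"
    using face_nonempty j k by blast
  have fc: "continuous_on S f" for S
    using f has_derivative_continuous continuous_at_imp_continuous_on by blast
  have jF: "j \<in> face k" and kF: "k \<in> face j"
    using j k jk by (simp_all add: hull_inc)
  have ek: "normal V (face k) \<bullet> e > 0"
    using normal_outward[OF k jF] by (simp add: e_def inner_diff_right)
  have ej: "normal V (face j) \<bullet> e < 0"
    using normal_outward[OF j kF] by (simp add: e_def)
  have ev: "normal V (face v) \<bullet> e = 0" if "v \<in> V" "v \<noteq> j" "v \<noteq> k" for v
    using normal_orth[OF that(1), of j k] that j k by (simp add: e_def hull_inc)
  have ek': "e \<bullet> normal V (face k) \<noteq> 0" and ej': "e \<bullet> normal V (face j) \<noteq> 0"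
    using ek ej by (simp_all add: inner_commute)
  \<comment> \<open>Both prisms extend in the direction \<open>e\<close> itself, so every line
    parallel to \<open>e\<close> that meets the simplex sees exactly the two endpoint values of
    \<open>f\<close>.\<close>
  have "integral (convex hull V) (\<lambda>x. D x e) =
      integral (prism (face k) e) (\<lambda>x. f (oblique_proj (normal V (face k)) a e x)) -
      integral (prism (face j) e) (\<lambda>x. f (oblique_proj (normal V (face j)) b e x))"
  proof (rule integral_compact_eq_if_line_integrals_eq[OF compact_hull _ compact_prism[OF compact_face] _
        compact_prism[OF compact_face] _ e0])
    show "continuous_on (convex hull V) (\<lambda>x. D x e)"
      using D by (auto simp: e_def intro: continuous_on_subset)
    show "continuous_on (prism (face k) e) (\<lambda>x. f (oblique_proj (normal V (face k)) a e x))"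
      using normal_orth[OF k _ a] by (intro continuous_on_prism ek' fc) (simp add: inner_commute)
    show "continuous_on (prism (face j) e) (\<lambda>x. f (oblique_proj (normal V (face j)) b e x))"
      using normal_orth[OF j _ b] by (intro continuous_on_prism ej' fc) (simp add: inner_commute)
    fix x
    define s where "s = bary x j"
    define r where "r = bary x k"
    \<comment> \<open>\<open>P\<close> says that the line meets the simplex at all. It does not
      involve the parameter \<open>t\<close>: only the coordinates of \<open>j\<close> and
      \<open>k\<close> vary along the line, and their sum is constant.\<close>
    define P where "P \<longleftrightarrow> (\<forall>v\<in>V - {j, k}. 0 \<le> bary x v) \<and> - s \<le> r"
    have line: "bary (x + t *\<^sub>R e) v = (if v = j then s + t else if v = k then r - t else bary x v)"
      if "v \<in> V" for v t
      using bary_edge[OF j k that, of x t] jk by (simp add: e_def s_def r_def)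
    have nonneg: "(\<forall>v\<in>V. 0 \<le> bary (x + t *\<^sub>R e) v) \<longleftrightarrow> P \<and> - s \<le> t \<and> t \<le> r" for t
    proof -
      have "(\<forall>v\<in>V. 0 \<le> bary (x + t *\<^sub>R e) v) \<longleftrightarrow>
          (\<forall>v\<in>V - {j, k}. 0 \<le> bary x v) \<and> 0 \<le> s + t \<and> 0 \<le> r - t"
        using j k jk by (auto simp: line)
      then show ?thesis by (auto simp: P_def)
    qed
    have K: "x + t *\<^sub>R e \<in> convex hull V \<longleftrightarrow> P \<and> t \<in> {- s..r}" for t
      using nonneg by (simp add: mem_hull_iff)
    have Fk: "x + t *\<^sub>R e \<in> face k \<longleftrightarrow> P \<and> t = r" for t
      using nonneg[of t] jk line[OF k] by (auto simp: mem_face_iff[OF k] P_def)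
    have Fj: "x + t *\<^sub>R e \<in> face j \<longleftrightarrow> P \<and> t = - s" for t
      using nonneg[of t] jk line[OF j] by (auto simp: mem_face_iff[OF j] P_def)
    have "integral {t. x + t *\<^sub>R e \<in> convex hull V} (\<lambda>t. D (x + t *\<^sub>R e) e) =
        (if P then f (x + r *\<^sub>R e) - f (x + (- s) *\<^sub>R e) else 0)"
    proof (cases P)
      case True
      then have "- s \<le> r" by (simp add: P_def)
      then have "((\<lambda>t. D (x + t *\<^sub>R e) e) has_integral f (x + r *\<^sub>R e) - f (x + (- s) *\<^sub>R e)) {- s..r}"
      proof (rule fundamental_theorem_of_calculus)
        fix t
        have "((\<lambda>t. f (x + t *\<^sub>R e)) has_derivative (\<lambda>h. D (x + t *\<^sub>R e) (h *\<^sub>R e))) (at t within {- s..r})"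
          by (rule has_derivative_compose[OF _ f]) (auto intro!: derivative_eq_intros)
        then show "((\<lambda>t. f (x + t *\<^sub>R e)) has_vector_derivative D (x + t *\<^sub>R e) e) (at t within {- s..r})"
          using has_derivative_bounded_linear[OF f]
          by (simp add: has_vector_derivative_def linear_simps(5))
      qed
      then show ?thesis
        using True by (simp only: K simp_thms Collect_mem_eq integral_unique if_True)
    qed (simp add: K)
    then show "integral {t. x + t *\<^sub>R e \<in> convex hull V} (\<lambda>t. D (x + t *\<^sub>R e) e) =
        integral {t. x + t *\<^sub>R e \<in> prism (face k) e}
          (\<lambda>t. f (oblique_proj (normal V (face k)) a e (x + t *\<^sub>R e))) -
        integral {t. x + t *\<^sub>R e \<in> prism (face j) e}
          (\<lambda>t. f (oblique_proj (normal V (face j)) b e (x + t *\<^sub>R e)))"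
      by (simp add: integral_prism_line_section[OF k a ek' Fk] integral_prism_line_section[OF j b ej' Fj])
  qed
  \<comment> \<open>The two absolute values resolve with opposite signs, which turns the difference
    into a sum weighted by the normals.\<close>
  also have "\<dots> = (normal V (face k) \<bullet> e) *\<^sub>R face_int V (face k) f + (normal V (face j) \<bullet> e) *\<^sub>R face_int V (face j) f"
    using ek ej by (simp add: face_int_oblique[OF k a ek' fc] face_int_oblique[OF j b ej' fc] inner_commute)
  also have "\<dots> = (\<Sum>v\<in>V. (normal V (face v) \<bullet> e) *\<^sub>R face_int V (face v) f)"
  proof -
    have "(\<Sum>v\<in>V. (normal V (face v) \<bullet> e) *\<^sub>R face_int V (face v) f) =
        (\<Sum>v\<in>{j, k}. (normal V (face v) \<bullet> e) *\<^sub>R face_int V (face v) f)"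
      using ev j k by (intro sum.mono_neutral_right finite_V) auto
    then show ?thesis using jk by simp
  qed
  finally show ?thesis by (simp add: e_def)
qed

theorem divergence_theorem:
  fixes f :: "real^'n \<Rightarrow> complex"
  assumes f: "\<And>x. (f has_derivative D x) (at x)"
    and D: "\<And>e. continuous_on UNIV (\<lambda>x. D x e)"
  shows "integral (convex hull V) (\<lambda>x. D x e) =
    (\<Sum>v\<in>V. (normal V (face v) \<bullet> e) *\<^sub>R face_int V (face v) f)"
proof -
  obtain k where k: "k \<in> V"
    using card_V by force
  have lin: "linear (D x)" for x
    using f has_derivative_linear by blast
  have int: "(\<lambda>x. D x e) integrable_on convex hull V" for e
    by (rule integrable_on_compact[OF compact_hull continuous_on_subset[OF D]]) simp
  \<comment> \<open>Affine independence of \<open>V\<close> makes the edges at \<open>k\<close>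
    linearly independent, and their number is the dimension, so they span the space.\<close>
  have "independent ((\<lambda>v. v - k) ` (V - {k}))"
    using indep_V affine_dependent_iff_dependent2[OF k] by simp
  moreover have "card ((\<lambda>v. v - k) ` (V - {k})) = CARD('n)"
    using k card_V finite_V by (subst card_image) (auto simp: inj_on_def)
  ultimately have "e \<in> span ((\<lambda>v. v - k) ` (V - {k}))"
    using card_eq_dim[of "(\<lambda>v. v - k) ` (V - {k})" UNIV] finite_V by (auto simp: subset_eq)
  then show ?thesis
  proof (induction rule: span_induct_alt)
    case base
    then show ?case using linear_0[OF lin] by simp
  next
    case (step c y e)
    then obtain j where j: "j \<in> V" "j \<noteq> k" "y = j - k" by auto
    have "integral (convex hull V) (\<lambda>x. D x (c *\<^sub>R y + e)) =
        c *\<^sub>R integral (convex hull V) (\<lambda>x. D x y) + integral (convex hull V) (\<lambda>x. D x e)"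
      using int by (simp add: linear_add[OF lin] linear_scale[OF lin] integral_add integrable_cmul)
    also have "\<dots> = c *\<^sub>R (\<Sum>v\<in>V. (normal V (face v) \<bullet> y) *\<^sub>R face_int V (face v) f) +
        (\<Sum>v\<in>V. (normal V (face v) \<bullet> e) *\<^sub>R face_int V (face v) f)"
      using divergence_theorem_edge[OF j(1) k j(2) f D] step by (simp add: j)
    finally show ?case
      by (simp add: inner_add_right scaleR_add_left sum.distrib scaleR_sum_right)
  qed
qed

end

section \<open>Finite-dimensional sesquilinear problems\<close>

text \<open>Gaussian elimination, one equation at a time: a pivot in row \<open>i0\<close> removes
  one equation and one unknown, which preserves the strict inequality of the counts.\<close>

lemma nontrivial_solution_underdetermined:
  fixes M :: "'i \<Rightarrow> 'j \<Rightarrow> 'a::field"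
  assumes "finite I" "finite J" "card I < card J"
  shows "\<exists>c. (\<exists>j\<in>J. c j \<noteq> 0) \<and> (\<forall>i\<in>I. (\<Sum>j\<in>J. M i j * c j) = 0)"
  using assms
proof (induction I arbitrary: J M rule: finite_induct)
  case empty
  then obtain j where "j \<in> J" by force
  then show ?case by (intro exI[of _ "\<lambda>_. 1"]) auto
next
  case (insert i0 I)
  show ?case
  proof (cases "\<forall>j\<in>J. M i0 j = 0")
    case True
    with insert.IH[OF insert.prems(1), of M] insert.hyps insert.prems show ?thesis by auto
  next
    case False
    then obtain j0 where j0: "j0 \<in> J" "M i0 j0 \<noteq> 0" by blast
    \<comment> \<open>The rows after subtracting the multiple of row \<open>i0\<close> that clears
      column \<open>j0\<close>.\<close>
    define N where "N = (\<lambda>i j. M i j - M i j0 * M i0 j / M i0 j0)"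
    have "card I < card (J - {j0})"
      using insert j0 by simp
    with insert.IH[of "J - {j0}" N] insert.prems obtain c where
      c: "\<exists>j\<in>J - {j0}. c j \<noteq> 0" "\<And>i. i \<in> I \<Longrightarrow> (\<Sum>j\<in>J - {j0}. N i j * c j) = 0"
      by auto
    define s where "s = (\<Sum>j\<in>J - {j0}. M i0 j * c j)"
    \<comment> \<open>The eliminated unknown is recovered from row \<open>i0\<close>.\<close>
    define d where "d = c(j0 := - s / M i0 j0)"
    have split: "(\<Sum>j\<in>J. M i j * d j) = M i j0 * (- s / M i0 j0) + (\<Sum>j\<in>J - {j0}. M i j * c j)" for i
      using j0(1) insert.prems by (simp add: sum.remove d_def)
    have "(\<Sum>j\<in>J. M i j * d j) = 0" if "i \<in> I" for i
    proof -
      have "(\<Sum>j\<in>J - {j0}. N i j * c j) = (\<Sum>j\<in>J - {j0}. M i j * c j) - (M i j0 / M i0 j0) * s"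
        by (simp add: N_def s_def left_diff_distrib sum_subtractf sum_distrib_left mult.assoc)
      then show ?thesis
        using c(2)[OF that] by (simp add: split)
    qed
    moreover have "(\<Sum>j\<in>J. M i0 j * d j) = 0"
      unfolding split using j0 by (simp add: s_def)
    moreover have "\<exists>j\<in>J. d j \<noteq> 0"
      using c(1) by (auto simp: d_def)
    ultimately show ?thesis by auto
  qed
qed

text \<open>Counting: with the right-hand side as an additional column, indexed by
  \<open>None\<close>, there are more unknowns than equations. By injectivity a nontrivial solution
  has a nonzero entry at \<open>None\<close>, and dividing by it solves the system.\<close>

lemma square_system_solvable:
  fixes M :: "'j \<Rightarrow> 'j \<Rightarrow> 'a::field"
  assumes J: "finite J"
    and inj: "\<And>c. (\<And>k. k \<in> J \<Longrightarrow> (\<Sum>j\<in>J. M k j * c j) = 0) \<Longrightarrow> (\<And>j. j \<in> J \<Longrightarrow> c j = 0)"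
  shows "\<exists>c. \<forall>k\<in>J. (\<Sum>j\<in>J. M k j * c j) = r k"
proof -
  define N where "N = (\<lambda>k j. case j of None \<Rightarrow> - r k | Some j \<Rightarrow> M k j)"
  let ?J = "insert None (Some ` J)"
  have "card J < card ?J"
    using J by (simp add: card_image)
  with nontrivial_solution_underdetermined[of J ?J N] J obtain c where
    c: "\<exists>j\<in>?J. c j \<noteq> 0" "\<And>k. k \<in> J \<Longrightarrow> (\<Sum>j\<in>?J. N k j * c j) = 0"
    by auto
  have eq: "(\<Sum>j\<in>J. M k j * c (Some j)) = r k * c None" if "k \<in> J" for k
    using c(2)[OF that] J by (simp add: N_def sum.reindex)
  have "c None \<noteq> 0"
  proof
    assume *: "c None = 0"
    then have "c (Some j) = 0" if "j \<in> J" for j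
      using inj[of "\<lambda>j. c (Some j)"] eq that by simp
    with * c(1) show False by auto
  qed
  then have "(\<Sum>j\<in>J. M k j * (c (Some j) / c None)) = r k" if "k \<in> J" for k
    using eq[OF that] by (simp add: sum_divide_distrib[symmetric])
  then show ?thesis by (intro exI ballI)
qed

text \<open>The generators may be linearly dependent, as traces of monomials on a face usually are;
  a basis is extracted only where coefficients have to be unique.\<close>

definition function_span :: "('j \<Rightarrow> 'x \<Rightarrow> complex) \<Rightarrow> 'j set \<Rightarrow> ('x \<Rightarrow> complex) set" where
  "function_span e J = {\<lambda>x. \<Sum>j\<in>J. c j * e j x | c. True}"

lemma function_spanI: "(\<And>x. w x = (\<Sum>j\<in>J. c j * e j x)) \<Longrightarrow> w \<in> function_span e J"
  unfolding function_span_def by auto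

lemma function_span_scale: "w \<in> function_span e J \<Longrightarrow> (\<lambda>x. c * w x) \<in> function_span e J"
  unfolding function_span_def by (auto simp: sum_distrib_left mult.assoc[symmetric])

lemma function_span_add:
  assumes "w \<in> function_span e J" "z \<in> function_span e J"
  shows "(\<lambda>x. w x + z x) \<in> function_span e J"
proof -
  obtain c d where "w = (\<lambda>x. \<Sum>j\<in>J. c j * e j x)" "z = (\<lambda>x. \<Sum>j\<in>J. d j * e j x)"
    using assms by (auto simp: function_span_def)
  then have "w x + z x = (\<Sum>j\<in>J. (c j + d j) * e j x)" for x
    by (simp add: distrib_right sum.distrib)
  then show ?thesis by (rule function_spanI)
qed

lemma function_span_base:
  assumes "finite J" "j \<in> J"
  shows "e j \<in> function_span e J"
proof -
  have "e j x = (\<Sum>i\<in>J. (if i = j then 1 else 0) * e i x)" for x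
    using assms by (simp add: if_distrib[of "\<lambda>c. c * _"] cong: if_cong)
  then show ?thesis by (rule function_spanI)
qed

lemma function_span_zero: "(\<lambda>x. 0) \<in> function_span e J"
  unfolding function_span_def by (auto intro!: exI[of _ "\<lambda>_. 0"])

lemma function_span_mono:
  assumes "finite J" "I \<subseteq> J"
  shows "function_span e I \<subseteq> function_span e J"
proof
  fix w assume "w \<in> function_span e I"
  then obtain c where w: "w = (\<lambda>x. \<Sum>j\<in>I. c j * e j x)"
    by (auto simp: function_span_def)
  have "w x = (\<Sum>j\<in>J. (if j \<in> I then c j else 0) * e j x)" for x
    unfolding w using assms by (intro sum.mono_neutral_cong_left) auto
  then show "w \<in> function_span e J" by (rule function_spanI)
qed

text \<open>A spanning subfamily of least cardinality is independent, since a relation with a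
  nonzero coefficient would allow one generator to be dropped.\<close>

lemma function_span_basis:
  assumes "finite J"
  obtains I where "I \<subseteq> J" "function_span e I = function_span e J"
    "\<And>c. (\<lambda>x. \<Sum>j\<in>I. c j * e j x) = (\<lambda>x. 0) \<Longrightarrow> \<forall>j\<in>I. c j = 0"
proof -
  let ?P = "\<lambda>I. I \<subseteq> J \<and> function_span e J \<subseteq> function_span e I"
  obtain I where I: "?P I" and min: "\<And>I'. ?P I' \<Longrightarrow> card I \<le> card I'"
    using ex_has_least_nat[of ?P J card] by blast
  have fin: "finite I" using I assms finite_subset by blast
  have indep: "\<forall>j\<in>I. c j = 0" if c: "(\<lambda>x. \<Sum>j\<in>I. c j * e j x) = (\<lambda>x. 0)" for c
  proof (rule ccontr)
    assume "\<not> (\<forall>j\<in>I. c j = 0)"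
    then obtain i where i: "i \<in> I" "c i \<noteq> 0" by blast
    have c0: "c i * e i x + (\<Sum>j\<in>I - {i}. c j * e j x) = 0" for x
      using fun_cong[OF c, of x] by (simp add: sum.remove[OF fin i(1)])
    have "function_span e I \<subseteq> function_span e (I - {i})"
    proof
      fix w assume "w \<in> function_span e I"
      then obtain d where w: "w = (\<lambda>x. \<Sum>j\<in>I. d j * e j x)"
        by (auto simp: function_span_def)
      \<comment> \<open>Replaces \<open>e i\<close> by its expression through the other generators,
        obtained from \<open>c0\<close>.\<close>
      have "w x = (\<Sum>j\<in>I - {i}. (d j - d i / c i * c j) * e j x)" for x
      proof -
        have "(\<Sum>j\<in>I - {i}. (d j - d i / c i * c j) * e j x) =
            (\<Sum>j\<in>I - {i}. d j * e j x) - d i / c i * (\<Sum>j\<in>I - {i}. c j * e j x)"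
          by (simp add: left_diff_distrib sum_subtractf sum_distrib_left mult.assoc)
        also have "(\<Sum>j\<in>I - {i}. c j * e j x) = - (c i * e i x)"
          using c0[of x] by (simp add: add_eq_0_iff2 add.commute)
        finally show ?thesis
          using i by (simp add: w sum.remove[OF fin i(1)])
      qed
      then show "w \<in> function_span e (I - {i})"
        by (rule function_spanI)
    qed
    with I have "card I \<le> card (I - {i})"
      by (intro min) auto
    with i fin show False
      by (metis card_Diff1_less not_less)
  qed
  have "function_span e I = function_span e J"
    using I function_span_mono[OF assms] by blast
  with I indep that show ?thesis by blast
qed

text \<open>Uniqueness gives existence because solutions and test functions range over the same
  span. It serves twice, for inverting a face operator and for the local problem. The assumptions
  are confined to \<open>W J\<close> since forms given by integrals are additive only on suitable
  functions.\<close>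

theorem sesquilinear_problem_solvable:
  fixes e :: "'j \<Rightarrow> 'x \<Rightarrow> complex"
    and B :: "('x \<Rightarrow> complex) \<Rightarrow> ('x \<Rightarrow> complex) \<Rightarrow> complex"
  defines "W J \<equiv> function_span e J"
  assumes J: "finite J"
    and add: "\<And>w w' z. w \<in> W J \<Longrightarrow> w' \<in> W J \<Longrightarrow> z \<in> W J \<Longrightarrow> B (\<lambda>x. w x + w' x) z = B w z + B w' z"
    and scale: "\<And>c w z. w \<in> W J \<Longrightarrow> z \<in> W J \<Longrightarrow> B (\<lambda>x. c * w x) z = c * B w z"
    and add': "\<And>w z z'. w \<in> W J \<Longrightarrow> z \<in> W J \<Longrightarrow> z' \<in> W J \<Longrightarrow> B w (\<lambda>x. z x + z' x) = B w z + B w z'"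
    and scale': "\<And>c w z. w \<in> W J \<Longrightarrow> z \<in> W J \<Longrightarrow> B w (\<lambda>x. c * z x) = cnj c * B w z"
    and radd: "\<And>z z'. z \<in> W J \<Longrightarrow> z' \<in> W J \<Longrightarrow> r (\<lambda>x. z x + z' x) = r z + r z'"
    and rscale: "\<And>c z. z \<in> W J \<Longrightarrow> r (\<lambda>x. c * z x) = cnj c * r z"
    and inj: "\<And>w. w \<in> W J \<Longrightarrow> (\<And>z. z \<in> W J \<Longrightarrow> B w z = 0) \<Longrightarrow> w = (\<lambda>x. 0)"
  shows "\<exists>w\<in>W J. \<forall>z\<in>W J. B w z = r z"
proof -
  obtain I where I: "I \<subseteq> J" "W I = W J"
    and indep: "\<And>c. (\<lambda>x. \<Sum>j\<in>I. c j * e j x) = (\<lambda>x. 0) \<Longrightarrow> \<forall>j\<in>I. c j = 0"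
    using function_span_basis[OF J, of e] unfolding W_def by blast
  have fin: "finite I" using I J finite_subset by blast
  have base: "e j \<in> W J" if "j \<in> I" for j
    using I J that by (auto simp: W_def intro: function_span_base)
  have W0: "(\<lambda>x. 0) \<in> W J"
    by (simp add: W_def function_span_zero)
  have comb: "(\<lambda>x. \<Sum>j\<in>I'. c j * e j x) \<in> W J" if "I' \<subseteq> I" for I' c
    using that function_span_mono[OF fin that, of e] I(2) unfolding W_def
    by (auto simp: function_span_def)
  have B0: "B (\<lambda>x. 0) z = 0" "B z (\<lambda>x. 0) = 0" "r (\<lambda>x. 0) = 0" if "z \<in> W J" for z
    using scale[OF W0 that, of 0] scale'[OF that W0, of 0] rscale[OF W0, of 0] by simp_all
  have Bsum: "B (\<lambda>x. \<Sum>j\<in>I'. c j * e j x) z = (\<Sum>j\<in>I'. c j * B (e j) z)"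
    if "finite I'" "I' \<subseteq> I" "z \<in> W J" for I' c z
    using that(1,2)
  proof (induction I' rule: finite_induct)
    case (insert j I')
    have "(\<lambda>x. c j * e j x) \<in> W J"
      using base[of j] insert.prems by (simp add: W_def function_span_scale)
    then show ?case
      using insert comb[of I' c] base[of j] that(3) by (simp add: add scale)
  qed (use B0 that in simp)
  \<comment> \<open>Conjugate-linear expansion, generic in \<open>h\<close> because it is applied to
    \<open>B ?w\<close> as well as to \<open>r\<close>.\<close>
  have anti: "h (\<lambda>x. \<Sum>j\<in>I'. c j * e j x) = (\<Sum>j\<in>I'. cnj (c j) * h (e j))"
    if "finite I'" "I' \<subseteq> I" "h (\<lambda>x. 0) = 0"
      and hadd: "\<And>z z'. z \<in> W J \<Longrightarrow> z' \<in> W J \<Longrightarrow> h (\<lambda>x. z x + z' x) = h z + h z'"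
      and hscale: "\<And>c z. z \<in> W J \<Longrightarrow> h (\<lambda>x. c * z x) = cnj c * h z" for h :: "('x \<Rightarrow> complex) \<Rightarrow> complex" and I' c
    using that(1,2)
  proof (induction I' rule: finite_induct)
    case (insert j I')
    have "(\<lambda>x. c j * e j x) \<in> W J"
      using base[of j] insert.prems by (simp add: W_def function_span_scale)
    then show ?case
      using insert comb[of I' c] base[of j] by (simp add: hadd hscale)
  qed (use that in simp)
  have repr: "\<exists>c. z = (\<lambda>x. \<Sum>j\<in>I. c j * e j x)" if "z \<in> W J" for z
    using that unfolding I(2)[symmetric] by (auto simp: W_def function_span_def)
  \<comment> \<open>Rows belong to test functions, columns to coefficients of the unknown.
    Independence of the family over \<open>I\<close> turns a vanishing combination into vanishing
    coefficients.\<close>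
  have "\<exists>c. \<forall>k\<in>I. (\<Sum>j\<in>I. B (e j) (e k) * c j) = r (e k)"
  proof (rule square_system_solvable[OF fin])
    fix c j assume c: "\<And>k. k \<in> I \<Longrightarrow> (\<Sum>j\<in>I. B (e j) (e k) * c j) = 0" and j: "j \<in> I"
    let ?w = "\<lambda>x. \<Sum>j\<in>I. c j * e j x"
    have w: "?w \<in> W J" by (rule comb) simp
    have wk: "B ?w (e k) = 0" if "k \<in> I" for k
      using c[OF that] by (simp add: Bsum[OF fin order_refl base[OF that]] mult.commute)
    have "B ?w z = 0" if "z \<in> W J" for z
    proof -
      obtain d where d: "z = (\<lambda>x. \<Sum>j\<in>I. d j * e j x)" using repr[OF \<open>z \<in> W J\<close>] by blast
      show ?thesis
        unfolding d using w by (subst anti[OF fin order_refl]) (auto simp: wk add' scale' B0)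
    qed
    then have "?w = (\<lambda>x. 0)" using inj[OF w] by blast
    then show "c j = 0" using indep j by blast
  qed
  then obtain c where c: "\<And>k. k \<in> I \<Longrightarrow> (\<Sum>j\<in>I. B (e j) (e k) * c j) = r (e k)" by blast
  let ?w = "\<lambda>x. \<Sum>j\<in>I. c j * e j x"
  have w: "?w \<in> W J" by (rule comb) simp
  have wk: "B ?w (e k) = r (e k)" if "k \<in> I" for k
    using c[OF that] by (simp add: Bsum[OF fin order_refl base[OF that]] mult.commute)
  have "B ?w z = r z" if "z \<in> W J" for z
  proof -
    obtain d where d: "z = (\<lambda>x. \<Sum>j\<in>I. d j * e j x)" using repr[OF \<open>z \<in> W J\<close>] by blast
    have "B ?w z = (\<Sum>j\<in>I. cnj (d j) * B ?w (e j))"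
      unfolding d using w by (intro anti[OF fin order_refl]) (auto simp: add' scale' B0)
    also have "\<dots> = (\<Sum>j\<in>I. cnj (d j) * r (e j))"
      by (simp add: wk)
    also have "\<dots> = r z"
      unfolding d using W0 by (intro anti[OF fin order_refl, symmetric]) (auto simp: radd rscale B0)
    finally show ?thesis .
  qed
  with w show ?thesis by blast
qed

section \<open>Polynomials\<close>

definition monomial :: "('n \<Rightarrow> nat) \<Rightarrow> real^'n \<Rightarrow> complex" where
  "monomial \<alpha> x = (\<Prod>i\<in>UNIV. complex_of_real (x $ i) ^ \<alpha> i)"

abbreviation multi_indices :: "nat \<Rightarrow> ('n::finite \<Rightarrow> nat) set" where
  "multi_indices p \<equiv> {\<alpha>. sum \<alpha> UNIV \<le> p}"

lemma finite_multi_indices: "finite (multi_indices p)"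
proof (rule finite_subset)
  show "multi_indices p \<subseteq> (UNIV :: 'n::finite set) \<rightarrow>\<^sub>E {..p}"
  proof (clarsimp simp: PiE_def extensional_def)
    fix \<alpha> :: "'n \<Rightarrow> nat" and i assume "sum \<alpha> UNIV \<le> p"
    moreover have "\<alpha> i \<le> sum \<alpha> UNIV" by (rule member_le_sum) auto
    ultimately show "\<alpha> i \<le> p" by simp
  qed
qed (auto intro: finite_PiE)

lemma polys_eq_span: "polys p = function_span monomial (multi_indices p)"
  by (simp add: polys_def function_span_def monomial_def)

lemma polys_add: "f \<in> polys p \<Longrightarrow> g \<in> polys p \<Longrightarrow> (\<lambda>x. f x + g x) \<in> polys p"
  and polys_scale: "f \<in> polys p \<Longrightarrow> (\<lambda>x. c * f x) \<in> polys p"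
  and polys_zero: "(\<lambda>x. 0) \<in> polys p"
  unfolding polys_eq_span by (fact function_span_add function_span_scale function_span_zero)+

lemma polys_sum:
  assumes "\<And>i. i \<in> I \<Longrightarrow> f i \<in> polys p"
  shows "(\<lambda>x. \<Sum>i\<in>I. f i x) \<in> polys p"
  using assms
proof (induction I rule: infinite_finite_induct)
  case (insert i I)
  then have "(\<lambda>x. f i x + (\<Sum>i\<in>I. f i x)) \<in> polys p"
    by (intro polys_add) blast+
  with insert.hyps show ?case by simp
qed (simp_all add: polys_zero)

lemma polys_mono: "p \<le> q \<Longrightarrow> polys p \<subseteq> polys q"
  unfolding polys_eq_span by (intro function_span_mono finite_multi_indices) auto

lemma monomial_in_polys: "sum \<alpha> UNIV \<le> p \<Longrightarrow> monomial \<alpha> \<in> polys p"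
  unfolding polys_eq_span by (intro function_span_base finite_multi_indices) auto

lemma polys_induct [consumes 1, case_names zero step]:
  fixes f :: "real^'n \<Rightarrow> complex"
  assumes "f \<in> polys p" and zero: "P (\<lambda>x. 0)"
    and step: "\<And>c \<alpha> f. sum \<alpha> UNIV \<le> p \<Longrightarrow> P f \<Longrightarrow> P (\<lambda>x. c * monomial \<alpha> x + f x)"
  shows "P f"
proof -
  obtain c where f: "f = (\<lambda>x. \<Sum>\<alpha>\<in>multi_indices p. c \<alpha> * monomial \<alpha> x)"
    using assms(1) by (auto simp: polys_eq_span function_span_def)
  have "P (\<lambda>x. \<Sum>\<alpha>\<in>I. c \<alpha> * monomial \<alpha> x)" if "finite I" "I \<subseteq> multi_indices p" for I
    using that
  proof (induction I rule: finite_induct)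
    case (insert \<alpha> I)
    then show ?case using step[of \<alpha>] by simp
  qed (simp add: zero)
  then show ?thesis unfolding f using finite_multi_indices by blast
qed

text \<open>For \<open>\<alpha> i = 0\<close> the truncated exponent \<open>\<alpha> i - 1\<close>
  is harmless, as its term carries the factor zero.\<close>

lemma has_derivative_monomial:
  fixes x :: "real^'n"
  shows "(monomial \<alpha> has_derivative
    (\<lambda>h. \<Sum>i\<in>UNIV. complex_of_real (h $ i) * (of_nat (\<alpha> i) * monomial (\<alpha>(i := \<alpha> i - 1)) x))) (at x)"
proof -
  have d: "((\<lambda>x. complex_of_real (x $ i) ^ \<alpha> i) has_derivative
      (\<lambda>h. of_nat (\<alpha> i) * complex_of_real (h $ i) * complex_of_real (x $ i) ^ (\<alpha> i - 1))) (at x)" for i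
  proof -
    have "((\<lambda>x. complex_of_real (x $ i)) has_derivative (\<lambda>h. complex_of_real (h $ i))) (at x)"
      by (intro bounded_linear_imp_has_derivative bounded_linear_of_real[THEN bounded_linear_compose]
          bounded_linear_vec_nth)
    then show ?thesis
      by (rule has_derivative_power)
  qed
  have m: "monomial (\<alpha>(i := \<alpha> i - 1)) x =
      complex_of_real (x $ i) ^ (\<alpha> i - 1) * (\<Prod>j\<in>UNIV - {i}. complex_of_real (x $ j) ^ \<alpha> j)" for i
    unfolding monomial_def by (subst prod.remove[of _ i]) auto
  have "((\<lambda>x. \<Prod>i\<in>UNIV. complex_of_real (x $ i) ^ \<alpha> i) has_derivative
    (\<lambda>h. \<Sum>i\<in>UNIV. of_nat (\<alpha> i) * complex_of_real (h $ i) * complex_of_real (x $ i) ^ (\<alpha> i - 1) *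
       (\<Prod>j\<in>UNIV - {i}. complex_of_real (x $ j) ^ \<alpha> j))) (at x)"
    by (rule has_derivative_prod) (use d in auto)
  moreover have "monomial \<alpha> = (\<lambda>x. \<Prod>i\<in>UNIV. complex_of_real (x $ i) ^ \<alpha> i)"
    by (simp add: fun_eq_iff monomial_def)
  ultimately show ?thesis
    by (simp only: m mult_ac)
qed

text \<open>\<open>grad\<close> is built from \<open>vector_derivative\<close>, a choice operator; a
  total derivative of this shape pins it down.\<close>

lemma grad_eqI:
  assumes "(f has_derivative (\<lambda>h. \<Sum>i\<in>UNIV. complex_of_real (h $ i) * g i)) (at x)"
  shows "grad f x $ i = g i"
proof -
  have ax: "(t *\<^sub>R axis i 1) $ j = (if j = i then t else 0)" for t :: real and j
    by (simp add: axis_def)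
  have "((\<lambda>t. x + t *\<^sub>R axis i 1) has_derivative (\<lambda>t. t *\<^sub>R axis i 1)) (at (0::real))"
    by (auto intro!: derivative_eq_intros)
  from has_derivative_compose[OF this, of f "\<lambda>h. \<Sum>i\<in>UNIV. complex_of_real (h $ i) * g i"] assms
  have "((\<lambda>t. f (x + t *\<^sub>R axis i 1)) has_derivative
      (\<lambda>t. \<Sum>j\<in>UNIV. complex_of_real ((t *\<^sub>R axis i 1) $ j) * g j)) (at 0)"
    by simp
  also have "(\<lambda>t. \<Sum>j\<in>UNIV. complex_of_real ((t *\<^sub>R axis i 1) $ j) * g j) = (\<lambda>t. t *\<^sub>R g i)"
    unfolding ax by (auto simp: if_distrib[of complex_of_real] if_distrib[of "\<lambda>c. c * _"] scaleR_conv_of_real cong: if_cong)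
  finally have "((\<lambda>t. f (x + t *\<^sub>R axis i 1)) has_vector_derivative g i) (at 0)"
    by (simp add: has_vector_derivative_def)
  then show ?thesis
    by (simp add: grad_def vector_derivative_at)
qed

text \<open>One induction yields the derivative, the degree bound and the constant case together.
  The last is recorded separately because the truncated \<open>p - 1\<close> hides the vanishing of
  the gradient at \<open>p = 0\<close>.\<close>

lemma
  fixes f :: "real^'n \<Rightarrow> complex"
  assumes "f \<in> polys p"
  shows has_derivative_polys: "(f has_derivative (\<lambda>h. \<Sum>i\<in>UNIV. complex_of_real (h $ i) * grad f x $ i)) (at x)"
    and grad_in_polys_pred: "(\<lambda>x. grad f x $ i) \<in> polys (p - 1)"
    and grad_const: "p = 0 \<Longrightarrow> grad f x = 0"
proof -
  have "\<exists>g. (\<forall>x. (f has_derivative (\<lambda>h. \<Sum>i\<in>UNIV. complex_of_real (h $ i) * g i x)) (at x)) \<and>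
      (\<forall>i. g i \<in> polys (p - 1)) \<and> (p = 0 \<longrightarrow> (\<forall>i x. g i x = 0))"
    using assms
  proof (induction rule: polys_induct)
    case zero
    show ?case by (intro exI[of _ "\<lambda>i x. 0"]) (simp add: polys_zero)
  next
    case (step c \<alpha> f)
    then obtain g where g: "\<And>x. (f has_derivative (\<lambda>h. \<Sum>i\<in>UNIV. complex_of_real (h $ i) * g i x)) (at x)"
      "\<And>i. g i \<in> polys (p - 1)" "\<And>i x. p = 0 \<Longrightarrow> g i x = 0"
      by blast
    let ?m = "\<lambda>i x. of_nat (\<alpha> i) * monomial (\<alpha>(i := \<alpha> i - 1)) x"
    have "((\<lambda>x. c * monomial \<alpha> x + f x) has_derivative
        (\<lambda>h. \<Sum>i\<in>UNIV. complex_of_real (h $ i) * (c * ?m i x + g i x))) (at x)" for x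
    proof -
      have "((\<lambda>x. c * monomial \<alpha> x + f x) has_derivative
        (\<lambda>h. c * (\<Sum>i\<in>UNIV. complex_of_real (h $ i) * ?m i x) + (\<Sum>i\<in>UNIV. complex_of_real (h $ i) * g i x))) (at x)"
        by (intro has_derivative_add has_derivative_mult_right has_derivative_monomial g)
      then show ?thesis
        by (simp add: distrib_left sum.distrib sum_distrib_left mult_ac)
    qed
    moreover have "(\<lambda>x. c * ?m i x + g i x) \<in> polys (p - 1)" for i
    proof -
      have "?m i \<in> polys (p - 1)"
      proof (cases "\<alpha> i = 0")
        case False
        have "sum \<alpha> UNIV = \<alpha> i + sum \<alpha> (UNIV - {i})"
          by (simp add: sum.remove)
        moreover have "sum (\<alpha>(i := \<alpha> i - 1)) UNIV = (\<alpha> i - 1) + sum \<alpha> (UNIV - {i})"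
          by (subst sum.remove[of _ i]) auto
        ultimately show ?thesis
          using step.hyps False by (intro polys_scale monomial_in_polys) simp
      qed (simp add: polys_zero)
      then show ?thesis by (intro polys_add polys_scale[of "?m i"] g)
    qed
    moreover have "c * ?m i x + g i x = 0" if "p = 0" for i x
      using step.hyps that g(3)[OF that] by simp
    ultimately show ?case
      by (intro exI[of _ "\<lambda>i x. c * ?m i x + g i x"]) blast
  qed
  then obtain g where g: "\<And>x. (f has_derivative (\<lambda>h. \<Sum>i\<in>UNIV. complex_of_real (h $ i) * g i x)) (at x)"
    "\<And>i. g i \<in> polys (p - 1)" "\<And>i x. p = 0 \<Longrightarrow> g i x = 0"
    by blast
  have eq: "grad f x $ i = g i x" for x i
    using grad_eqI[OF g(1)] .
  show "(f has_derivative (\<lambda>h. \<Sum>i\<in>UNIV. complex_of_real (h $ i) * grad f x $ i)) (at x)"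
    unfolding eq by (rule g(1))
  show "(\<lambda>x. grad f x $ i) \<in> polys (p - 1)"
    unfolding eq using g(2) by simp
  show "grad f x = 0" if "p = 0"
    using g(3)[OF that] by (simp add: vec_eq_iff eq)
qed

lemma grad_in_polys: "f \<in> polys p \<Longrightarrow> (\<lambda>x. grad f x $ i) \<in> polys p"
  using grad_in_polys_pred polys_mono[of "p - 1" p] by auto

lemma continuous_on_polys: "f \<in> polys p \<Longrightarrow> continuous_on S f"
  by (intro continuous_at_imp_continuous_on ballI has_derivative_continuous[OF has_derivative_polys])

lemma grad_add:
  assumes "f \<in> polys p" "g \<in> polys p"
  shows "grad (\<lambda>x. f x + g x) x $ i = grad f x $ i + grad g x $ i"
proof (rule grad_eqI)
  show "((\<lambda>x. f x + g x) has_derivative (\<lambda>h. \<Sum>i\<in>UNIV. complex_of_real (h $ i) * (grad f x $ i + grad g x $ i))) (at x)"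
    using has_derivative_add[OF has_derivative_polys[OF assms(1)] has_derivative_polys[OF assms(2)]]
    by (simp add: distrib_left sum.distrib)
qed

lemma grad_scale:
  assumes "f \<in> polys p"
  shows "grad (\<lambda>x. c * f x) x $ i = c * grad f x $ i"
proof (rule grad_eqI)
  show "((\<lambda>x. c * f x) has_derivative (\<lambda>h. \<Sum>i\<in>UNIV. complex_of_real (h $ i) * (c * grad f x $ i))) (at x)"
    using has_derivative_mult_right[OF has_derivative_polys[OF assms], of c]
    by (simp add: sum_distrib_left mult_ac)
qed

lemma dvg_eq_grad: "dvg v x = (\<Sum>i\<in>UNIV. grad (\<lambda>x. v x $ i) x $ i)"
  by (simp add: dvg_def grad_def)

lemma polys_on_line:
  assumes "f \<in> polys p"
  shows "\<exists>r. \<forall>t. f (x + t *\<^sub>R y) = poly r (complex_of_real t)"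
  using assms
proof (induction rule: polys_induct)
  case zero
  show ?case by (intro exI[of _ 0]) simp
next
  case (step c \<alpha> f)
  then obtain r where r: "\<And>t. f (x + t *\<^sub>R y) = poly r (complex_of_real t)" by blast
  let ?m = "\<Prod>i\<in>UNIV. [:complex_of_real (x $ i), complex_of_real (y $ i):] ^ \<alpha> i"
  have "monomial \<alpha> (x + t *\<^sub>R y) = poly ?m (complex_of_real t)" for t
    by (simp add: monomial_def poly_prod poly_power)
  with r show ?case
    by (intro exI[of _ "smult c ?m + r"]) simp
qed

text \<open>On the line through a point of \<open>S\<close> and an arbitrary \<open>y\<close>,
  \<open>f\<close> is a univariate polynomial with infinitely many zeros.\<close>

lemma polys_eq_zero_if_open:
  assumes f: "f \<in> polys p" and S: "open S" "S \<noteq> {}" and z: "\<And>x. x \<in> S \<Longrightarrow> f x = 0"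
  shows "f = (\<lambda>x. 0)"
proof
  fix y
  obtain x where x: "x \<in> S" using S by blast
  obtain r where r: "\<And>t. f (x + t *\<^sub>R (y - x)) = poly r (complex_of_real t)"
    using polys_on_line[OF f] by blast
  have "open ((\<lambda>t. x + t *\<^sub>R (y - x)) -` S)"
    using S(1) by (intro open_vimage continuous_intros)
  moreover have "0 \<in> (\<lambda>t. x + t *\<^sub>R (y - x)) -` S" using x by simp
  ultimately have "infinite ((\<lambda>t. x + t *\<^sub>R (y - x)) -` S)"
    using finite_imp_not_open by blast
  then have "infinite (complex_of_real ` ((\<lambda>t. x + t *\<^sub>R (y - x)) -` S))"
    by (subst finite_image_iff) (auto simp: inj_on_def)
  moreover have "complex_of_real ` ((\<lambda>t. x + t *\<^sub>R (y - x)) -` S) \<subseteq> {z. poly r z = 0}"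
    using z by (auto simp: r[symmetric])
  ultimately have "r = 0"
    using poly_roots_finite finite_subset by blast
  then show "f y = 0" using r[of 1] by simp
qed

section \<open>Inner products and Green's formula\<close>

lemma vpolys_add: "u \<in> vpolys p \<Longrightarrow> v \<in> vpolys p \<Longrightarrow> (\<lambda>x. u x + v x) \<in> vpolys p"
  unfolding vpolys_def by (simp add: polys_add)

lemma vpolys_scale: "u \<in> vpolys p \<Longrightarrow> (\<lambda>x. c *s u x) \<in> vpolys p"
  unfolding vpolys_def by (simp add: polys_scale)

lemma vpolys_zero: "(\<lambda>x. 0) \<in> vpolys p"
  unfolding vpolys_def by (simp add: polys_zero)

lemma vpolys_nth: "u \<in> vpolys p \<Longrightarrow> (\<lambda>x. u x $ i) \<in> polys p"
  by (simp add: vpolys_def)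

lemma vpolys_grad: "f \<in> polys p \<Longrightarrow> grad f \<in> vpolys p"
  by (simp add: vpolys_def grad_in_polys)

lemma polys_dvg: "u \<in> vpolys p \<Longrightarrow> dvg u \<in> polys p"
  unfolding dvg_eq_grad[abs_def] by (intro polys_sum grad_in_polys vpolys_nth)

lemma polys_ncomp: "u \<in> vpolys p \<Longrightarrow> ncomp n u \<in> polys p"
  unfolding ncomp_def[abs_def] by (intro polys_sum polys_scale vpolys_nth)

lemma dvg_add: "u \<in> vpolys p \<Longrightarrow> v \<in> vpolys p \<Longrightarrow> dvg (\<lambda>x. u x + v x) = (\<lambda>x. dvg u x + dvg v x)"
  by (simp add: fun_eq_iff dvg_eq_grad grad_add[OF vpolys_nth vpolys_nth] sum.distrib)

lemma dvg_scale: "u \<in> vpolys p \<Longrightarrow> dvg (\<lambda>x. c *s u x) = (\<lambda>x. c * dvg u x)"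
  by (simp add: fun_eq_iff dvg_eq_grad grad_scale[OF vpolys_nth] sum_distrib_left)

lemma ncomp_add: "ncomp n (\<lambda>x. u x + v x) = (\<lambda>x. ncomp n u x + ncomp n v x)"
  by (simp add: ncomp_def fun_eq_iff distrib_left sum.distrib)

lemma ncomp_scale: "ncomp n (\<lambda>x. c *s u x) = (\<lambda>x. c * ncomp n u x)"
  by (simp add: ncomp_def fun_eq_iff sum_distrib_left mult_ac)

lemma tr_add: "tr F (\<lambda>x. f x + g x) = (\<lambda>x. tr F f x + tr F g x)"
  and tr_scale: "tr F (\<lambda>x. c * f x) = (\<lambda>x. c * tr F f x)"
  by (auto simp: tr_def)

lemma tr_in_face_polys: "q \<in> polys p \<Longrightarrow> tr F q \<in> face_polys F p"
  by (auto simp: face_polys_def)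

lemma face_polys_eq_span: "face_polys F p = function_span (\<lambda>\<alpha>. tr F (monomial \<alpha>)) (multi_indices p)"
proof -
  have *: "tr F (\<lambda>x. \<Sum>\<alpha>\<in>multi_indices p. c \<alpha> * monomial \<alpha> x) =
      (\<lambda>x. \<Sum>\<alpha>\<in>multi_indices p. c \<alpha> * tr F (monomial \<alpha>) x)" for c
    by (auto simp: tr_def fun_eq_iff)
  show ?thesis
    unfolding face_polys_def polys_eq_span function_span_def by (auto simp: *)
qed

lemma face_polys_add: "\<phi> \<in> face_polys F p \<Longrightarrow> \<psi> \<in> face_polys F p \<Longrightarrow> (\<lambda>x. \<phi> x + \<psi> x) \<in> face_polys F p"
  and face_polys_scale: "\<phi> \<in> face_polys F p \<Longrightarrow> (\<lambda>x. c * \<phi> x) \<in> face_polys F p"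
  and face_polys_zero: "(\<lambda>x. 0) \<in> face_polys F p"
  unfolding face_polys_eq_span by (fact function_span_add function_span_scale function_span_zero)+

lemma continuous_on_face_polys:
  assumes "\<phi> \<in> face_polys F p"
  shows "continuous_on F \<phi>"
proof -
  obtain q where q: "q \<in> polys p" "\<phi> = tr F q"
    using assms by (auto simp: face_polys_def)
  have "continuous_on F \<phi> \<longleftrightarrow> continuous_on F q"
    by (rule continuous_on_cong) (auto simp: q tr_def)
  then show ?thesis using continuous_on_polys[OF q(1)] by simp
qed

lemma polys_laplace_eigenfunction_zero:
  assumes "f \<in> polys p" and "\<And>x. f x = c * dvg (grad f) x"
  shows "f = (\<lambda>x. 0)"
  using assms(1)
proof (induction p)
  case 0
  have "(\<lambda>x. grad f x $ i) = (\<lambda>x. 0)" for i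
    using grad_const[OF 0] by simp
  then have "dvg (grad f) x = 0" for x
    using grad_const[OF polys_zero[of 0] refl, of x] by (simp add: dvg_eq_grad del: sum.neutral_const)
  then show ?case using assms(2) by (simp add: fun_eq_iff)
next
  case (Suc p)
  \<comment> \<open>The gradient alone lowers the degree bound by one, which is enough for the
    induction; the divergence just does not raise it.\<close>
  have "grad f \<in> vpolys p"
    using grad_in_polys_pred[OF Suc.prems] by (simp add: vpolys_def)
  then have "(\<lambda>x. c * dvg (grad f) x) \<in> polys p"
    by (intro polys_scale polys_dvg)
  moreover have "f = (\<lambda>x. c * dvg (grad f) x)"
    by (rule ext) (rule assms(2))
  ultimately show ?case using Suc.IH by simp
qed

lemma
  fixes f g h :: "real^'n \<Rightarrow> complex"
  assumes K: "compact K"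
    and cont: "continuous_on K f" "continuous_on K g" "continuous_on K h"
  shows vol_ip_add_left: "vol_ip K (\<lambda>x. f x + g x) h = vol_ip K f h + vol_ip K g h"
    and vol_ip_add_right: "vol_ip K h (\<lambda>x. f x + g x) = vol_ip K h f + vol_ip K h g"
proof -
  have int: "(\<lambda>x. f x * cnj (g x)) integrable_on K"
    if "continuous_on K f" "continuous_on K g" for f g :: "real^'n \<Rightarrow> complex"
    by (intro integrable_on_compact K continuous_intros that)
  show "vol_ip K (\<lambda>x. f x + g x) h = vol_ip K f h + vol_ip K g h"
    "vol_ip K h (\<lambda>x. f x + g x) = vol_ip K h f + vol_ip K h g"
    using int cont by (simp_all add: vol_ip_def distrib_left distrib_right integral_add)
qed

lemma vol_ip_scale_left: "vol_ip K (\<lambda>x. c * f x) g = c * vol_ip K f g"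
  by (simp add: vol_ip_def mult.assoc)

lemma vol_ip_scale_right: "vol_ip K f (\<lambda>x. c * g x) = cnj c * vol_ip K f g"
  by (simp add: vol_ip_def mult.left_commute)

lemma vol_ip_cnj: "cnj (vol_ip K f g) = vol_ip K g f"
  by (simp add: vol_ip_def integral_cnj mult.commute)

text \<open>A continuous nonnegative function with zero integral vanishes on a box inside
  \<open>K\<close>, and a polynomial vanishing on a box is zero everywhere. Identities obtained by
  testing thus hold on the whole space and can be differentiated.\<close>

lemma vol_ip_definite:
  assumes K: "compact K" "interior K \<noteq> {}" and f: "f \<in> polys p" and z: "vol_ip K f f = 0"
  shows "f = (\<lambda>x. 0)"
proof -
  obtain y where "y \<in> interior K" using K by blast
  then obtain a b where ab: "cbox a b \<subseteq> interior K" "y \<in> box a b"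
    using open_contains_cbox[OF open_interior] by metis
  define g where "g = (\<lambda>x. (cmod (f x))\<^sup>2)"
  have cont: "continuous_on S g" for S
    unfolding g_def by (intro continuous_intros continuous_on_polys[OF f])
  have int: "g integrable_on K"
    by (rule integrable_on_compact[OF K(1) cont])
  have "vol_ip K f f = complex_of_real (integral K g)"
    using integral_linear[OF int bounded_linear_of_real[where 'a=complex]]
    by (simp add: vol_ip_def g_def o_def flip: complex_norm_square)
  then have "integral K g = 0" using z by simp
  moreover have "integral (cbox a b) g \<le> integral K g"
    using ab(1) interior_subset[of K] int
    by (intro integral_subset_le integrable_continuous cont) (auto simp: g_def)
  moreover have "0 \<le> integral (cbox a b) g"
    by (intro integral_nonneg integrable_continuous cont) (simp add: g_def)
  ultimately have "integral (cbox a b) g = 0" by simp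
  then have "(g has_integral 0) (cbox a b)"
    using integrable_integral[OF integrable_continuous[OF cont], of a b] by simp
  then have "g x = 0" if "x \<in> cbox a b" for x
    using ab(2) that by (intro has_integral_0_cbox_imp_0[OF cont]) (auto simp: g_def)
  then have "f x = 0" if "x \<in> box a b" for x
    using that box_subset_cbox[of a b] by (auto simp: g_def)
  then show ?thesis
    using ab(2) by (intro polys_eq_zero_if_open[OF f open_box]) auto
qed

lemma vvol_ip_eq_sum:
  assumes K: "compact K" and u: "u \<in> vpolys p" "v \<in> vpolys q"
  shows "vvol_ip K u v = (\<Sum>i\<in>UNIV. vol_ip K (\<lambda>x. u x $ i) (\<lambda>x. v x $ i))"
  unfolding vvol_ip_def vol_ip_def
  by (intro integral_sum integrable_on_compact K continuous_intros
      continuous_on_polys[OF vpolys_nth[OF u(1)]] continuous_on_polys[OF vpolys_nth[OF u(2)]]) simp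

lemma
  assumes K: "compact K" and u: "u \<in> vpolys p" "v \<in> vpolys p" "w \<in> vpolys p"
  shows vvol_ip_add_left: "vvol_ip K (\<lambda>x. u x + v x) w = vvol_ip K u w + vvol_ip K v w"
    and vvol_ip_add_right: "vvol_ip K w (\<lambda>x. u x + v x) = vvol_ip K w u + vvol_ip K w v"
  using continuous_on_polys[OF vpolys_nth[OF u(1)]] continuous_on_polys[OF vpolys_nth[OF u(2)]]
    continuous_on_polys[OF vpolys_nth[OF u(3)]]
  by (simp_all add: vvol_ip_eq_sum[OF K u(1) u(3)] vvol_ip_eq_sum[OF K u(2) u(3)]
      vvol_ip_eq_sum[OF K u(3) u(1)] vvol_ip_eq_sum[OF K u(3) u(2)]
      vvol_ip_eq_sum[OF K vpolys_add[OF u(1,2)] u(3)] vvol_ip_eq_sum[OF K u(3) vpolys_add[OF u(1,2)]]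
      vol_ip_add_left[OF K] vol_ip_add_right[OF K] sum.distrib)

lemma vvol_ip_scale_left: "vvol_ip K (\<lambda>x. c *s u x) v = c * vvol_ip K u v"
proof -
  have "(\<Sum>i\<in>UNIV. (c *s u x) $ i * cnj (v x $ i)) = c * (\<Sum>i\<in>UNIV. u x $ i * cnj (v x $ i))" for x
    by (simp add: sum_distrib_left mult.assoc)
  then show ?thesis by (simp add: vvol_ip_def)
qed

lemma vvol_ip_cnj: "cnj (vvol_ip K u v) = vvol_ip K v u"
  by (simp add: vvol_ip_def integral_cnj mult.commute)

lemma vvol_ip_scale_right: "vvol_ip K u (\<lambda>x. c *s v x) = cnj c * vvol_ip K u v"
  by (metis complex_cnj_mult vvol_ip_cnj vvol_ip_scale_left)

lemma vvol_ip_orthogonal_imp_zero: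
  assumes K: "compact K" "interior K \<noteq> {}" and u: "u \<in> vpolys p"
    and z: "\<And>v. v \<in> vpolys p \<Longrightarrow> vvol_ip K u v = 0"
  shows "u = (\<lambda>x. 0)"
proof -
  have "(\<lambda>x. u x $ i) = (\<lambda>x. 0)" for i
  proof (rule vol_ip_definite[OF K vpolys_nth[OF u]])
    \<comment> \<open>Keeps a single component, which reduces the vector inner product to the scalar
      one.\<close>
    let ?v = "\<lambda>x. \<chi> j. if j = i then u x $ i else 0"
    have "(\<lambda>x. ?v x $ j) \<in> polys p" for j
      by (cases "j = i") (simp_all add: polys_zero vpolys_nth[OF u])
    then have v: "?v \<in> vpolys p"
      unfolding vpolys_def by blast
    have *: "vol_ip K (\<lambda>x. u x $ j) (\<lambda>x. ?v x $ j) =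
        (if j = i then vol_ip K (\<lambda>x. u x $ i) (\<lambda>x. u x $ i) else 0)" for j
      by (simp add: vol_ip_def)
    have "vvol_ip K u ?v = vol_ip K (\<lambda>x. u x $ i) (\<lambda>x. u x $ i)"
      unfolding vvol_ip_eq_sum[OF K(1) u v] * by simp
    then show "vol_ip K (\<lambda>x. u x $ i) (\<lambda>x. u x $ i) = 0"
      using z[OF v] by simp
  qed
  then show ?thesis by (simp add: fun_eq_iff vec_eq_iff)
qed

section \<open>Surface integrals and Green's formula on the simplex\<close>

context full_simplex
begin

lemma interior_hull: "interior (convex hull V) \<noteq> {}"
proof -
  have "affine hull (convex hull V) = UNIV"
    using affine_hull_V by simp
  then have "rel_interior (convex hull V) = interior (convex hull V)"
    by (rule rel_interior_interior)
  moreover have "convex hull V \<noteq> {}"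
    using card_V by auto
  ultimately show ?thesis
    using rel_interior_eq_empty[OF convex_convex_hull] by blast
qed

text \<open>Hides the chosen base point, so that additivity, scaling and congruence of surface
  integrals become those of one volume integral.\<close>

lemma face_int_prism:
  assumes k: "k \<in> V"
  obtains a where "\<And>f. face_int V (face k) f =
      integral (prism (face k) (normal V (face k))) (\<lambda>x. f (oblique_proj (normal V (face k)) a (normal V (face k)) x))"
    and "\<And>f :: real^'n \<Rightarrow> complex. continuous_on (face k) f \<Longrightarrow>
      (\<lambda>x. f (oblique_proj (normal V (face k)) a (normal V (face k)) x)) integrable_on prism (face k) (normal V (face k))"
    and "\<And>x. x \<in> prism (face k) (normal V (face k)) \<Longrightarrow>
      oblique_proj (normal V (face k)) a (normal V (face k)) x \<in> face k"
proof
  let ?n = "normal V (face k)"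
  define a where "a = (SOME a. a \<in> face k)"
  have a: "a \<in> face k"
    unfolding a_def by (rule someI_ex) (use face_nonempty[OF k] in blast)
  have nn: "?n \<bullet> ?n = 1"
    using norm_normal[OF k] by (simp add: norm_eq_1)
  have orth: "(y - a) \<bullet> ?n = 0" if "y \<in> face k" for y
    using normal_orth[OF k that a] by (simp add: inner_commute)
  show "face_int V (face k) f = integral (prism (face k) ?n) (\<lambda>x. f (oblique_proj ?n a ?n x))" for f
    by (simp add: face_int_def Let_def a_def prism_def oblique_proj_def oblique_height_def nn)
  show "(\<lambda>x. f (oblique_proj ?n a ?n x)) integrable_on prism (face k) ?n" if "continuous_on (face k) f" for f :: "_ \<Rightarrow> complex"
    using nn by (intro integrable_on_compact compact_prism compact_face continuous_on_prism orth that) auto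
  show "oblique_proj ?n a ?n x \<in> face k" if "x \<in> prism (face k) ?n" for x
    using mem_prism_iff[of ?n ?n "face k" a x] nn orth that by auto
qed

lemma face_int_add:
  assumes k: "k \<in> V" and f: "continuous_on (face k) f" "continuous_on (face k) g"
  shows "face_int V (face k) (\<lambda>x. f x + g x) = face_int V (face k) f + face_int V (face k) g"
  by (rule face_int_prism[OF k]) (use f in \<open>simp add: integral_add\<close>)

lemma face_int_scale:
  assumes k: "k \<in> V"
  shows "face_int V (face k) (\<lambda>x. c * f x) = c * face_int V (face k) f"
  by (rule face_int_prism[OF k]) simp

lemma face_int_zero:
  assumes k: "k \<in> V"
  shows "face_int V (face k) (\<lambda>x. 0) = 0"
  by (rule face_int_prism[OF k]) simp

lemma face_int_cong:
  assumes k: "k \<in> V" and f: "\<And>x. x \<in> face k \<Longrightarrow> f x = g x"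
  shows "face_int V (face k) f = face_int V (face k) g"
  by (rule face_int_prism[OF k]) (use f in \<open>auto intro!: integral_cong\<close>)

lemma face_int_sum:
  assumes k: "k \<in> V" and f: "\<And>i. i \<in> I \<Longrightarrow> continuous_on (face k) (f i)"
  shows "face_int V (face k) (\<lambda>x. \<Sum>i\<in>I. f i x) = (\<Sum>i\<in>I. face_int V (face k) (f i))"
  using f
proof (induction I rule: infinite_finite_induct)
  case (insert i I)
  then have "continuous_on (face k) (\<lambda>x. \<Sum>i\<in>I. f i x)"
    by (intro continuous_on_sum) auto
  with insert show ?case by (simp add: face_int_add[OF k])
qed (simp_all add: face_int_zero[OF k])

lemma
  assumes k: "k \<in> V" and f: "continuous_on (face k) f" "continuous_on (face k) g" "continuous_on (face k) h"
  shows face_ip_add_left: "face_ip V (face k) (\<lambda>x. f x + g x) h = face_ip V (face k) f h + face_ip V (face k) g h"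
    and face_ip_add_right: "face_ip V (face k) h (\<lambda>x. f x + g x) = face_ip V (face k) h f + face_ip V (face k) h g"
proof -
  have c: "continuous_on (face k) (\<lambda>x. f x * cnj (g x))"
    if "continuous_on (face k) f" "continuous_on (face k) g" for f g
    by (intro continuous_intros that)
  show "face_ip V (face k) (\<lambda>x. f x + g x) h = face_ip V (face k) f h + face_ip V (face k) g h"
    "face_ip V (face k) h (\<lambda>x. f x + g x) = face_ip V (face k) h f + face_ip V (face k) h g"
    using c f by (simp_all add: face_ip_def distrib_left distrib_right face_int_add[OF k])
qed

lemma face_ip_scale_left: "k \<in> V \<Longrightarrow> face_ip V (face k) (\<lambda>x. c * f x) g = c * face_ip V (face k) f g"
  by (simp add: face_ip_def face_int_scale mult.assoc)

lemma face_ip_scale_right: "k \<in> V \<Longrightarrow> face_ip V (face k) f (\<lambda>x. c * g x) = cnj c * face_ip V (face k) f g"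
  by (simp add: face_ip_def face_int_scale mult.left_commute)

lemma face_ip_cong:
  assumes k: "k \<in> V" and "\<And>x. x \<in> face k \<Longrightarrow> f x = f' x" "\<And>x. x \<in> face k \<Longrightarrow> g x = g' x"
  shows "face_ip V (face k) f g = face_ip V (face k) f' g'"
  unfolding face_ip_def using assms by (intro face_int_cong) auto

lemma face_ip_tr: "k \<in> V \<Longrightarrow> face_ip V (face k) f (tr (face k) g) = face_ip V (face k) f g"
  by (rule face_ip_cong) (auto simp: tr_def)

lemma face_ip_zero:
  assumes "k \<in> V"
  shows "face_ip V (face k) (\<lambda>x. 0) g = 0" "face_ip V (face k) f (\<lambda>x. 0) = 0"
  using assms by (simp_all add: face_ip_def face_int_zero)

text \<open>The divergence theorem for each scalar field \<open>u x $ i * cnj (q x)\<close> in the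
  corresponding coordinate direction, summed over the components.\<close>

theorem green_formula:
  assumes u: "u \<in> vpolys p" and q: "q \<in> polys p"
  shows "vol_ip (convex hull V) (dvg u) q + vvol_ip (convex hull V) u (grad q) =
    (\<Sum>k\<in>V. face_ip V (face k) (ncomp (normal V (face k)) u) q)"
proof -
  let ?K = "convex hull V"
  note cu = continuous_on_polys[OF vpolys_nth[OF u]]
  note cgu = continuous_on_polys[OF grad_in_polys[OF vpolys_nth[OF u]]]
  note cq = continuous_on_polys[OF q]
  note cgq = continuous_on_polys[OF grad_in_polys[OF q]]
  define f where "f = (\<lambda>i x. u x $ i * cnj (q x))"
  \<comment> \<open>The product rule; \<open>cnj\<close> passes to the gradient of \<open>q\<close>
    because the directions \<open>h\<close> are real.\<close>
  define D where "D = (\<lambda>i x h. \<Sum>j\<in>UNIV. complex_of_real (h $ j) *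
    (grad (\<lambda>x. u x $ i) x $ j * cnj (q x) + u x $ i * cnj (grad q x $ j)))"
  have deriv: "(f i has_derivative D i x) (at x)" for i x
  proof -
    have "((\<lambda>x. cnj (q x)) has_derivative (\<lambda>h. cnj (\<Sum>j\<in>UNIV. complex_of_real (h $ j) * grad q x $ j))) (at x)"
      by (intro bounded_linear.has_derivative[OF bounded_linear_cnj] has_derivative_polys[OF q])
    from has_derivative_mult[OF has_derivative_polys[OF vpolys_nth[OF u, of i]] this]
    show ?thesis
      unfolding f_def D_def
      by (rule has_derivative_eq_rhs)
        (simp add: fun_eq_iff sum_distrib_left sum_distrib_right sum.distrib distrib_left mult_ac)
  qed
  have cont: "continuous_on UNIV (\<lambda>x. D i x e)" for i e
    unfolding D_def by (intro continuous_intros cu cgu cq cgq)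
  have D_axis: "D i x (axis i 1) = grad (\<lambda>x. u x $ i) x $ i * cnj (q x) + u x $ i * cnj (grad q x $ i)" for i x
    unfolding D_def axis_def by (simp add: if_distrib[of complex_of_real] if_distrib[of "\<lambda>c. c * _"] cong: if_cong)
  have int: "(\<lambda>x. D i x e) integrable_on ?K" for i e
    by (rule integrable_on_compact[OF compact_hull continuous_on_subset[OF cont]]) simp
  have "vol_ip ?K (dvg u) q + vvol_ip ?K u (grad q) =
      integral ?K (\<lambda>x. dvg u x * cnj (q x) + (\<Sum>i\<in>UNIV. u x $ i * cnj (grad q x $ i)))"
    unfolding vol_ip_def vvol_ip_def
    by (intro integral_add[symmetric] integrable_on_compact compact_hull continuous_intros cu cq cgq
        continuous_on_polys[OF polys_dvg[OF u]])
  also have "\<dots> = integral ?K (\<lambda>x. \<Sum>i\<in>UNIV. D i x (axis i 1))"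
    by (simp add: D_axis dvg_eq_grad sum.distrib sum_distrib_right)
  also have "\<dots> = (\<Sum>i\<in>UNIV. integral ?K (\<lambda>x. D i x (axis i 1)))"
    by (intro integral_sum int) simp
  also have "\<dots> = (\<Sum>i\<in>UNIV. \<Sum>k\<in>V. complex_of_real (normal V (face k) $ i) * face_int V (face k) (f i))"
    unfolding divergence_theorem[OF deriv cont]
    by (simp add: inner_axis scaleR_conv_of_real)
  also have "\<dots> = (\<Sum>k\<in>V. \<Sum>i\<in>UNIV. complex_of_real (normal V (face k) $ i) * face_int V (face k) (f i))"
    by (rule sum.swap)
  also have "\<dots> = (\<Sum>k\<in>V. face_ip V (face k) (ncomp (normal V (face k)) u) q)"
  proof (rule sum.cong[OF refl])
    fix k assume k: "k \<in> V"
    let ?n = "normal V (face k)"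
    have "face_ip V (face k) (ncomp ?n u) q =
        face_int V (face k) (\<lambda>x. \<Sum>i\<in>UNIV. complex_of_real (?n $ i) * f i x)"
      by (simp add: face_ip_def ncomp_def f_def sum_distrib_right mult.assoc)
    also have "\<dots> = (\<Sum>i\<in>UNIV. face_int V (face k) (\<lambda>x. complex_of_real (?n $ i) * f i x))"
      unfolding f_def by (intro face_int_sum k continuous_intros cu cq)
    finally show "(\<Sum>i\<in>UNIV. complex_of_real (?n $ i) * face_int V (face k) (f i)) =
        face_ip V (face k) (ncomp ?n u) q"
      by (simp add: face_int_scale[OF k])
  qed
  finally show ?thesis .
qed

end

section \<open>The local problem\<close>

locale face_operator = full_simplex V for V :: "(real^'n) set" +
  fixes k :: "real^'n" and p :: nat and A :: "(real^'n \<Rightarrow> complex) \<Rightarrow> real^'n \<Rightarrow> complex"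
  assumes k: "k \<in> V" and good: "good_face_op V (face k) p A"
begin

abbreviation "P \<equiv> face_polys (face k) p"
abbreviation "Ainv \<equiv> inv_into P A"

lemma A_closed: "\<phi> \<in> P \<Longrightarrow> A \<phi> \<in> P"
  and A_add: "\<phi> \<in> P \<Longrightarrow> \<psi> \<in> P \<Longrightarrow> A (\<lambda>x. \<phi> x + \<psi> x) = (\<lambda>x. A \<phi> x + A \<psi> x)"
  and A_scale: "\<phi> \<in> P \<Longrightarrow> A (\<lambda>x. c * \<phi> x) = (\<lambda>x. c * A \<phi> x)"
  and A_self_adjoint: "\<phi> \<in> P \<Longrightarrow> \<psi> \<in> P \<Longrightarrow> face_ip V (face k) (A \<phi>) \<psi> = face_ip V (face k) \<phi> (A \<psi>)"
  and A_pos: "\<phi> \<in> P \<Longrightarrow> \<phi> \<noteq> (\<lambda>x. 0) \<Longrightarrow> 0 < Re (face_ip V (face k) (A \<phi>) \<phi>)"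
  using good unfolding good_face_op_def by blast+

lemma A_zero: "A (\<lambda>x. 0) = (\<lambda>x. 0)"
  using A_scale[OF face_polys_zero, of 0] by simp

lemma A_eq_zero_imp: "\<phi> \<in> P \<Longrightarrow> A \<phi> = (\<lambda>x. 0) \<Longrightarrow> \<phi> = (\<lambda>x. 0)"
  using A_pos[of \<phi>] face_ip_zero[OF k] by fastforce

lemma inj_on_A: "inj_on A P"
proof (rule inj_onI)
  fix \<phi> \<psi> assume *: "\<phi> \<in> P" "\<psi> \<in> P" "A \<phi> = A \<psi>"
  have "A (\<lambda>x. \<phi> x + (- 1) * \<psi> x) = (\<lambda>x. A \<phi> x + (- 1) * A \<psi> x)"
    using *(1,2) by (simp only: A_add A_scale face_polys_scale)
  also have "\<dots> = (\<lambda>x. 0)"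
    using *(3) by simp
  finally have "(\<lambda>x. \<phi> x + (- 1) * \<psi> x) = (\<lambda>x. 0)"
    by (rule A_eq_zero_imp[OF face_polys_add[OF *(1) face_polys_scale[OF *(2)]]])
  then show "\<phi> = \<psi>" by (simp add: fun_eq_iff)
qed

text \<open>Definiteness of the face inner product is drawn from \<open>A\<close> itself: testing
  with \<open>A \<delta>\<close> makes the quantity in \<open>A_pos\<close> vanish.\<close>

lemma eq_zero_if_orthogonal:
  assumes \<delta>: "\<delta> \<in> P" and z: "\<And>\<psi>. \<psi> \<in> P \<Longrightarrow> face_ip V (face k) \<delta> \<psi> = 0"
  shows "\<delta> = (\<lambda>x. 0)"
proof (rule ccontr)
  assume "\<delta> \<noteq> (\<lambda>x. 0)"
  from A_pos[OF \<delta> this] show False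
    using z[OF A_closed[OF \<delta>]] by (simp add: A_self_adjoint[OF \<delta> \<delta>])
qed

text \<open>Positivity makes the form pairing \<open>A w\<close> with \<open>z\<close>
  nondegenerate, so some \<open>\<phi>\<close> represents the functional given by
  \<open>\<theta>\<close>. Then \<open>A \<phi>\<close> and \<open>\<theta>\<close> agree because
  their difference is orthogonal to all of \<open>P\<close>.\<close>

lemma A_surj:
  assumes \<theta>: "\<theta> \<in> P"
  shows "\<exists>\<phi>\<in>P. A \<phi> = \<theta>"
proof -
  note cont = continuous_on_face_polys
  have "\<exists>w\<in>P. \<forall>z\<in>P. face_ip V (face k) (A w) z = face_ip V (face k) \<theta> z"
    unfolding face_polys_eq_span
  proof (rule sesquilinear_problem_solvable[OF finite_multi_indices]; unfold face_polys_eq_span[symmetric])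
    show "face_ip V (face k) (A (\<lambda>x. w x + w' x)) z = face_ip V (face k) (A w) z + face_ip V (face k) (A w') z"
      if "w \<in> P" "w' \<in> P" "z \<in> P" for w w' z
      unfolding A_add[OF that(1,2)] by (intro face_ip_add_left k cont[of _ _ p] A_closed that)
    show "face_ip V (face k) (A (\<lambda>x. c * w x)) z = c * face_ip V (face k) (A w) z"
      if "w \<in> P" "z \<in> P" for c w z
      unfolding A_scale[OF that(1)] by (rule face_ip_scale_left[OF k])
    show "face_ip V (face k) (A w) (\<lambda>x. z x + z' x) = face_ip V (face k) (A w) z + face_ip V (face k) (A w) z'"
      if "w \<in> P" "z \<in> P" "z' \<in> P" for w z z'
      by (intro face_ip_add_right k cont[of _ _ p] A_closed that)
    show "face_ip V (face k) \<theta> (\<lambda>x. z x + z' x) = face_ip V (face k) \<theta> z + face_ip V (face k) \<theta> z'"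
      if "z \<in> P" "z' \<in> P" for z z'
      by (intro face_ip_add_right k cont[of _ _ p] that \<theta>)
    show "w = (\<lambda>x. 0)" if "w \<in> P" "\<And>z. z \<in> P \<Longrightarrow> face_ip V (face k) (A w) z = 0" for w
      by (rule A_eq_zero_imp[OF that(1) eq_zero_if_orthogonal[OF A_closed[OF that(1)] that(2)]])
  qed (simp_all add: face_ip_scale_right[OF k])
  then obtain \<phi> where \<phi>: "\<phi> \<in> P" "\<And>z. z \<in> P \<Longrightarrow> face_ip V (face k) (A \<phi>) z = face_ip V (face k) \<theta> z"
    by blast
  have "(\<lambda>x. A \<phi> x + (- 1) * \<theta> x) = (\<lambda>x. 0)"
  proof (rule eq_zero_if_orthogonal)
    show "(\<lambda>x. A \<phi> x + (- 1) * \<theta> x) \<in> P"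
      by (intro face_polys_add face_polys_scale A_closed \<phi> \<theta>)
    show "face_ip V (face k) (\<lambda>x. A \<phi> x + (- 1) * \<theta> x) \<psi> = 0" if "\<psi> \<in> P" for \<psi>
    proof -
      have "face_ip V (face k) (\<lambda>x. A \<phi> x + (- 1) * \<theta> x) \<psi> =
          face_ip V (face k) (A \<phi>) \<psi> + face_ip V (face k) (\<lambda>x. (- 1) * \<theta> x) \<psi>"
        by (intro face_ip_add_left k cont[of _ _ p] face_polys_scale A_closed \<phi> \<theta> that)
      then show ?thesis
        using \<phi>(2)[OF that] face_ip_scale_left[OF k, of "- 1" \<theta> \<psi>] by simp
    qed
  qed
  then have "A \<phi> = \<theta>" by (simp add: fun_eq_iff)
  with \<phi> show ?thesis by blast
qed

lemma Ainv_closed: "\<phi> \<in> P \<Longrightarrow> Ainv \<phi> \<in> P"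
  and A_Ainv: "\<phi> \<in> P \<Longrightarrow> A (Ainv \<phi>) = \<phi>"
proof -
  assume "\<phi> \<in> P"
  then have "\<phi> \<in> A ` P" using A_surj by blast
  then show "Ainv \<phi> \<in> P" "A (Ainv \<phi>) = \<phi>"
    by (rule inv_into_into, rule f_inv_into_f)
qed

lemma Ainv_eqI: "\<psi> \<in> P \<Longrightarrow> A \<psi> = \<phi> \<Longrightarrow> Ainv \<phi> = \<psi>"
  using inj_on_A inv_into_f_f by metis

lemma Ainv_add: "\<phi> \<in> P \<Longrightarrow> \<psi> \<in> P \<Longrightarrow> Ainv (\<lambda>x. \<phi> x + \<psi> x) = (\<lambda>x. Ainv \<phi> x + Ainv \<psi> x)"
  by (rule Ainv_eqI) (simp_all add: face_polys_add Ainv_closed A_add A_Ainv)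

lemma Ainv_scale: "\<phi> \<in> P \<Longrightarrow> Ainv (\<lambda>x. c * \<phi> x) = (\<lambda>x. c * Ainv \<phi> x)"
  by (rule Ainv_eqI) (simp_all add: face_polys_scale Ainv_closed A_scale A_Ainv)

lemma Ainv_zero: "Ainv (\<lambda>x. 0) = (\<lambda>x. 0)"
  by (rule Ainv_eqI) (simp_all add: face_polys_zero A_zero)

text \<open>With \<open>\<psi> = Ainv \<phi>\<close> this is the pairing of \<open>\<psi>\<close>
  with \<open>A \<psi>\<close>, positive by self-adjointness and \<open>A_pos\<close>.\<close>

lemma Ainv_pos:
  assumes "\<phi> \<in> P" "\<phi> \<noteq> (\<lambda>x. 0)"
  shows "0 < Re (face_ip V (face k) (Ainv \<phi>) \<phi>)"
proof -
  have "Ainv \<phi> \<noteq> (\<lambda>x. 0)"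
    using A_Ainv[OF assms(1)] assms(2) A_zero by auto
  from A_pos[OF Ainv_closed[OF assms(1)] this] show ?thesis
    using A_self_adjoint[OF Ainv_closed Ainv_closed] A_Ainv assms(1) by simp
qed

end

section \<open>The two forms of the local problem: linearity and uniqueness\<close>

locale local_problem = full_simplex V for V :: "(real^'n) set" +
  fixes p :: nat and \<kappa> \<eta> :: real
    and A :: "(real^'n) set \<Rightarrow> (real^'n \<Rightarrow> complex) \<Rightarrow> (real^'n \<Rightarrow> complex)"
  assumes kappa: "\<kappa> > 0" and eta: "\<eta> > 0"
    and good: "\<And>k. k \<in> V \<Longrightarrow> good_face_op V (face k) p (A (face k))"
begin

lemma face_op: "k \<in> V \<Longrightarrow> face_operator V k p (A (face k))"
  by unfold_locales (use good in auto)

abbreviation "K \<equiv> convex hull V"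
abbreviation "nrm k \<equiv> normal V (face k)"
abbreviation "Ainv k \<equiv> inv_into (face_polys (face k) p) (A (face k))"

definition form1 :: "(real^'n \<Rightarrow> complex) \<Rightarrow> (real^'n \<Rightarrow> complex^'n) \<Rightarrow> (real^'n \<Rightarrow> complex) \<Rightarrow> complex" where
  "form1 f u q = - \<i> * vol_ip K (\<lambda>x. complex_of_real (\<kappa> / \<eta>) * f x) q - vvol_ip K u (grad q)
     + (\<Sum>k\<in>V. face_ip V (face k) (\<lambda>x. ncomp (nrm k) u x + Ainv k (tr (face k) f) x) q)"

definition form2 :: "(real^'n \<Rightarrow> complex) \<Rightarrow> (real^'n \<Rightarrow> complex^'n) \<Rightarrow> (real^'n \<Rightarrow> complex^'n) \<Rightarrow> complex" where
  "form2 f u v = - \<i> * vvol_ip K (\<lambda>x. (\<kappa> * \<eta>) *\<^sub>R u x) v - vol_ip K f (dvg v)"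

lemma scaleR_eq_smult: "(r::real) *\<^sub>R (u :: complex^'n) = complex_of_real r *s u"
  by (subst vec_eq_iff) (simp add: scaleR_conv_of_real[where 'a=complex])

lemma form2_eq: "form2 f u v = - \<i> * (\<kappa> * \<eta>) * vvol_ip K u v - vol_ip K f (dvg v)"
  unfolding form2_def scaleR_eq_smult vvol_ip_scale_left by simp

lemma form1_eq:
  assumes f: "f \<in> polys p" and u: "u \<in> vpolys p" and q: "q \<in> polys p"
  shows "form1 f u q = - \<i> * (\<kappa> / \<eta>) * vol_ip K f q - vvol_ip K u (grad q)
     + (\<Sum>k\<in>V. face_ip V (face k) (ncomp (nrm k) u) q)
     + (\<Sum>k\<in>V. face_ip V (face k) (Ainv k (tr (face k) f)) q)"
proof -
  have "face_ip V (face k) (\<lambda>x. ncomp (nrm k) u x + Ainv k (tr (face k) f) x) q =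
      face_ip V (face k) (ncomp (nrm k) u) q + face_ip V (face k) (Ainv k (tr (face k) f)) q"
    if k: "k \<in> V" for k
    by (intro face_ip_add_left k continuous_on_polys[OF polys_ncomp[OF u]] continuous_on_polys[OF q]
        continuous_on_face_polys[OF face_operator.Ainv_closed[OF face_op[OF k]]] tr_in_face_polys f)
  then show ?thesis
    unfolding form1_def vol_ip_scale_left by (simp add: sum.distrib)
qed

text \<open>Integration by parts cancels the normal trace of \<open>u\<close> and leaves no
  derivative on \<open>q\<close>. In this form the \<open>dvg u\<close> term matches the conjugate
  of the one in \<open>form2\<close>, and the residual of the first equation can be read
  off.\<close>

lemma form1_eq_green:
  assumes f: "f \<in> polys p" and u: "u \<in> vpolys p" and q: "q \<in> polys p"
  shows "form1 f u q = - \<i> * (\<kappa> / \<eta>) * vol_ip K f q + vol_ip K (dvg u) q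
     + (\<Sum>k\<in>V. face_ip V (face k) (Ainv k (tr (face k) f)) q)"
  unfolding form1_eq[OF assms] using green_formula[OF u q] by (simp add: algebra_simps)

lemma form1_add:
  assumes f: "f \<in> polys p" "f' \<in> polys p" and u: "u \<in> vpolys p" "u' \<in> vpolys p" and q: "q \<in> polys p"
  shows "form1 (\<lambda>x. f x + f' x) (\<lambda>x. u x + u' x) q = form1 f u q + form1 f' u' q"
proof -
  have "face_ip V (face k) (Ainv k (tr (face k) (\<lambda>x. f x + f' x))) q =
      face_ip V (face k) (Ainv k (tr (face k) f)) q + face_ip V (face k) (Ainv k (tr (face k) f')) q"
    if k: "k \<in> V" for k
  proof -
    interpret op: face_operator V k p "A (face k)" by (rule face_op[OF k])
    show ?thesis
      unfolding tr_add op.Ainv_add[OF f[THEN tr_in_face_polys]]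
      by (intro face_ip_add_left k continuous_on_polys[OF q]
          continuous_on_face_polys[OF op.Ainv_closed] tr_in_face_polys f)
  qed
  then show ?thesis
    unfolding form1_eq_green[OF f(1) u(1) q] form1_eq_green[OF f(2) u(2) q]
      form1_eq_green[OF polys_add[OF f] vpolys_add[OF u] q] dvg_add[OF u]
    by (simp add: vol_ip_add_left[OF compact_hull] continuous_on_polys[OF f(1)] continuous_on_polys[OF f(2)]
        continuous_on_polys[OF q] continuous_on_polys[OF polys_dvg[OF u(1)]]
        continuous_on_polys[OF polys_dvg[OF u(2)]] sum.distrib algebra_simps)
qed

lemma form1_scale:
  assumes f: "f \<in> polys p" and u: "u \<in> vpolys p" and q: "q \<in> polys p"
  shows "form1 (\<lambda>x. c * f x) (\<lambda>x. c *s u x) q = c * form1 f u q"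
proof -
  have "face_ip V (face k) (Ainv k (tr (face k) (\<lambda>x. c * f x))) q =
      c * face_ip V (face k) (Ainv k (tr (face k) f)) q" if k: "k \<in> V" for k
    unfolding tr_scale face_operator.Ainv_scale[OF face_op[OF k] tr_in_face_polys[OF f]]
    by (rule face_ip_scale_left[OF k])
  then show ?thesis
    unfolding form1_eq_green[OF f u q] form1_eq_green[OF polys_scale[OF f] vpolys_scale[OF u] q]
      dvg_scale[OF u] vol_ip_scale_left
    by (simp add: sum_distrib_left algebra_simps)
qed

lemma form1_add_right:
  assumes f: "f \<in> polys p" and u: "u \<in> vpolys p" and q: "q \<in> polys p" "q' \<in> polys p"
  shows "form1 f u (\<lambda>x. q x + q' x) = form1 f u q + form1 f u q'"
proof -
  have "face_ip V (face k) (Ainv k (tr (face k) f)) (\<lambda>x. q x + q' x) =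
      face_ip V (face k) (Ainv k (tr (face k) f)) q + face_ip V (face k) (Ainv k (tr (face k) f)) q'"
    if k: "k \<in> V" for k
    by (intro face_ip_add_right k continuous_on_polys[OF q(1)] continuous_on_polys[OF q(2)]
        continuous_on_face_polys[OF face_operator.Ainv_closed[OF face_op[OF k]]] tr_in_face_polys f)
  then show ?thesis
    unfolding form1_eq_green[OF f u q(1)] form1_eq_green[OF f u q(2)] form1_eq_green[OF f u polys_add[OF q]]
    by (simp add: vol_ip_add_right[OF compact_hull] continuous_on_polys[OF f] continuous_on_polys[OF q(1)]
        continuous_on_polys[OF q(2)] continuous_on_polys[OF polys_dvg[OF u]] sum.distrib algebra_simps)
qed

lemma form1_scale_right:
  assumes f: "f \<in> polys p" and u: "u \<in> vpolys p" and q: "q \<in> polys p"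
  shows "form1 f u (\<lambda>x. c * q x) = cnj c * form1 f u q"
  unfolding form1_eq_green[OF f u q] form1_eq_green[OF f u polys_scale[OF q]] vol_ip_scale_right
  by (simp add: face_ip_scale_right sum_distrib_left algebra_simps)

lemma form2_add:
  assumes f: "f \<in> polys p" "f' \<in> polys p" and u: "u \<in> vpolys p" "u' \<in> vpolys p" and v: "v \<in> vpolys p"
  shows "form2 (\<lambda>x. f x + f' x) (\<lambda>x. u x + u' x) v = form2 f u v + form2 f' u' v"
  unfolding form2_eq vvol_ip_add_left[OF compact_hull u v]
  by (simp add: vol_ip_add_left[OF compact_hull] continuous_on_polys[OF f(1)] continuous_on_polys[OF f(2)]
      continuous_on_polys[OF polys_dvg[OF v]] algebra_simps)

lemma form2_scale: "form2 (\<lambda>x. c * f x) (\<lambda>x. c *s u x) v = c * form2 f u v"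
  unfolding form2_eq vvol_ip_scale_left vol_ip_scale_left by (simp add: algebra_simps)

lemma form2_add_right:
  assumes f: "f \<in> polys p" and u: "u \<in> vpolys p" and v: "v \<in> vpolys p" "v' \<in> vpolys p"
  shows "form2 f u (\<lambda>x. v x + v' x) = form2 f u v + form2 f u v'"
  unfolding form2_eq vvol_ip_add_right[OF compact_hull v u] dvg_add[OF v]
  by (simp add: vol_ip_add_right[OF compact_hull] continuous_on_polys[OF f]
      continuous_on_polys[OF polys_dvg[OF v(1)]] continuous_on_polys[OF polys_dvg[OF v(2)]] algebra_simps)

lemma form2_scale_right: "v \<in> vpolys p \<Longrightarrow> form2 f u (\<lambda>x. c *s v x) = cnj c * form2 f u v"
  unfolding form2_eq vvol_ip_scale_right by (simp add: dvg_scale vol_ip_scale_right algebra_simps)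

lemma trace_eq_zero:
  assumes f: "f \<in> polys p" and u: "u \<in> vpolys p" and z: "form1 f u f = 0" "form2 f u u = 0" and k: "k \<in> V"
  shows "tr (face k) f = (\<lambda>x. 0)"
proof -
  let ?s = "\<lambda>k. face_ip V (face k) (Ainv k (tr (face k) f)) f"
  have real: "Im (vol_ip K f f) = 0" "Im (vvol_ip K u u) = 0"
    using vol_ip_cnj[of K f f] vvol_ip_cnj[of K u u] by (simp_all add: complex_eq_iff)
  have "form1 f u f + cnj (form2 f u u) =
      \<i> * (\<kappa> * \<eta>) * vvol_ip K u u - \<i> * (\<kappa> / \<eta>) * vol_ip K f f + (\<Sum>k\<in>V. ?s k)"
    unfolding form1_eq_green[OF f u f] form2_eq by (simp add: vol_ip_cnj vvol_ip_cnj)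
  then have "Re (\<Sum>k\<in>V. ?s k) = 0"
    using z real by (simp add: complex_eq_iff)
  then have sum0: "(\<Sum>k\<in>V. Re (?s k)) = 0" by simp
  \<comment> \<open>Positivity of the inverse concerns the trace in both slots;
    \<open>face_ip_tr\<close> exchanges the second one for \<open>f\<close> itself.\<close>
  have pos: "0 < Re (?s k)" if "k \<in> V" "tr (face k) f \<noteq> (\<lambda>x. 0)" for k
    using face_operator.Ainv_pos[OF face_op[OF that(1)] tr_in_face_polys[OF f] that(2)]
    by (simp add: face_ip_tr[OF that(1)])
  have nonneg: "0 \<le> Re (?s k)" if "k \<in> V" for k
  proof (cases "tr (face k) f = (\<lambda>x. 0)")
    case True
    then show ?thesis
      using face_operator.Ainv_zero[OF face_op[OF that]] face_ip_zero[OF that] by simp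
  qed (use pos[OF that] in simp)
  \<comment> \<open>A vanishing sum of nonnegative terms, each strictly positive unless its trace is
    zero.\<close>
  show ?thesis
    using pos[OF k] sum_nonneg_eq_0_iff[OF finite_V, of "\<lambda>k. Re (?s k)"] nonneg sum0 k by force
qed

theorem homogeneous_solution_zero:
  assumes f: "f \<in> polys p" and u: "u \<in> vpolys p"
    and z1: "\<And>q. q \<in> polys p \<Longrightarrow> form1 f u q = 0" and z2: "\<And>v. v \<in> vpolys p \<Longrightarrow> form2 f u v = 0"
  shows "f = (\<lambda>x. 0) \<and> u = (\<lambda>x. 0)"
proof -
  have tr0: "tr (face k) f = (\<lambda>x. 0)" if "k \<in> V" for k
    by (rule trace_eq_zero[OF f u z1[OF f] z2[OF u] that])
  have face0: "face_ip V (face k) g f = 0" if "k \<in> V" for k g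
    using face_ip_tr[OF that, of g f] tr0[OF that] face_ip_zero[OF that] by simp
  define \<mu> where "\<mu> = \<i> * complex_of_real (\<kappa> * \<eta>)"
  have \<mu>: "\<mu> \<noteq> 0" using kappa eta by (simp add: \<mu>_def)
  \<comment> \<open>The residual of the second equation. Its orthogonality to every \<open>v\<close>
    is that equation after Green's formula, whose boundary terms vanish with
    \<open>f\<close>.\<close>
  have "(\<lambda>x. grad f x + (- \<mu>) *s u x) = (\<lambda>x. 0)"
  proof (rule vvol_ip_orthogonal_imp_zero[OF compact_hull interior_hull])
    show "(\<lambda>x. grad f x + (- \<mu>) *s u x) \<in> vpolys p"
      by (intro vpolys_add vpolys_scale vpolys_grad f u)
    fix v :: "real^'n \<Rightarrow> complex^'n" assume v: "v \<in> vpolys p"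
    have "vol_ip K (dvg v) f + vvol_ip K v (grad f) = 0"
      unfolding green_formula[OF v f] by (simp add: face0)
    then have "cnj (vol_ip K (dvg v) f + vvol_ip K v (grad f)) = 0" by simp
    then have "vol_ip K f (dvg v) + vvol_ip K (grad f) v = 0"
      by (simp add: vol_ip_cnj vvol_ip_cnj)
    moreover have "vvol_ip K (\<lambda>x. grad f x + (- \<mu>) *s u x) v = vvol_ip K (grad f) v - \<mu> * vvol_ip K u v"
      by (subst vvol_ip_add_left[OF compact_hull vpolys_grad[OF f] vpolys_scale[OF u] v])
        (simp only: vvol_ip_scale_left, simp)
    moreover have "- \<mu> * vvol_ip K u v - vol_ip K f (dvg v) = 0"
      using z2[OF v] by (simp add: form2_eq \<mu>_def)
    ultimately show "vvol_ip K (\<lambda>x. grad f x + (- \<mu>) *s u x) v = 0"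
      by (simp add: add_eq_0_iff2 algebra_simps)
  qed
  then have grad_eq: "grad f = (\<lambda>x. \<mu> *s u x)"
    by (simp add: fun_eq_iff vec_eq_iff)
  define \<nu> where "\<nu> = \<i> * complex_of_real (\<kappa> / \<eta>)"
  have \<nu>: "\<nu> \<noteq> 0" using kappa eta by (simp add: \<nu>_def)
  \<comment> \<open>The residual of the first equation, used as its own test function; the face
    terms have dropped out with the trace of \<open>f\<close>.\<close>
  let ?d = "\<lambda>x. dvg u x + (- \<nu>) * f x"
  have d: "?d \<in> polys p"
    by (intro polys_add polys_scale polys_dvg f u)
  have "?d = (\<lambda>x. 0)"
  proof (rule vol_ip_definite[OF compact_hull interior_hull d])
    have "form1 f u ?d = - \<nu> * vol_ip K f ?d + vol_ip K (dvg u) ?d"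
      unfolding form1_eq_green[OF f u d]
      using tr0 face_operator.Ainv_zero[OF face_op] face_ip_zero by (simp add: \<nu>_def)
    moreover have "vol_ip K ?d ?d = vol_ip K (dvg u) ?d + vol_ip K (\<lambda>x. (- \<nu>) * f x) ?d"
      by (intro vol_ip_add_left compact_hull continuous_on_polys[OF d] continuous_on_polys[OF polys_dvg[OF u]]
          continuous_on_polys[OF polys_scale[OF f]])
    ultimately show "vol_ip K ?d ?d = 0"
      using z1[OF d] by (simp only: vol_ip_scale_left) simp
  qed
  then have "dvg u x = \<nu> * f x" for x
    by (simp add: fun_eq_iff)
  \<comment> \<open>\<open>\<mu> * \<nu>\<close> is minus the square of \<open>\<kappa>\<close>:
    this is a Helmholtz equation, which has nonzero solutions in general but none among
    polynomials.\<close>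
  then have "f x = inverse (\<mu> * \<nu>) * dvg (grad f) x" for x
    using \<mu> \<nu> by (simp add: grad_eq dvg_scale[OF u] field_simps)
  then have f0: "f = (\<lambda>x. 0)"
    by (rule polys_laplace_eigenfunction_zero[OF f])
  then have "grad f x = 0" for x
    using grad_const[OF polys_zero[of 0] refl] by simp
  then have "u = (\<lambda>x. 0)"
    using \<mu> by (simp add: grad_eq fun_eq_iff)
  with f0 show ?thesis by simp
qed

section \<open>Data functionals and existence\<close>

definition rhs1 :: "((real^'n) set \<Rightarrow> real^'n \<Rightarrow> complex) \<Rightarrow> (real^'n \<Rightarrow> complex) \<Rightarrow> complex" where
  "rhs1 ph q = (\<Sum>k\<in>V. face_ip V (face k) (Ainv k (ph (face k))) q)"

definition rhs2 :: "((real^'n) set \<Rightarrow> real^'n \<Rightarrow> complex) \<Rightarrow> (real^'n \<Rightarrow> complex^'n) \<Rightarrow> complex" where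
  "rhs2 ph v = - (\<Sum>k\<in>V. face_ip V (face k) (ph (face k)) (ncomp (nrm k) v))"

lemma
  assumes ph: "\<And>k. k \<in> V \<Longrightarrow> ph (face k) \<in> face_polys (face k) p"
    and q: "q \<in> polys p" "q' \<in> polys p"
  shows rhs1_add: "rhs1 ph (\<lambda>x. q x + q' x) = rhs1 ph q + rhs1 ph q'"
    and rhs1_scale: "rhs1 ph (\<lambda>x. c * q x) = cnj c * rhs1 ph q"
proof -
  have "face_ip V (face k) (Ainv k (ph (face k))) (\<lambda>x. q x + q' x) =
      face_ip V (face k) (Ainv k (ph (face k))) q + face_ip V (face k) (Ainv k (ph (face k))) q'"
    if k: "k \<in> V" for k
    by (intro face_ip_add_right k continuous_on_polys[OF q(1)] continuous_on_polys[OF q(2)]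
        continuous_on_face_polys[OF face_operator.Ainv_closed[OF face_op[OF k]]] ph)
  then show "rhs1 ph (\<lambda>x. q x + q' x) = rhs1 ph q + rhs1 ph q'"
    by (simp add: rhs1_def sum.distrib)
  show "rhs1 ph (\<lambda>x. c * q x) = cnj c * rhs1 ph q"
    by (simp add: rhs1_def sum_distrib_left face_ip_scale_right)
qed

lemma
  assumes ph: "\<And>k. k \<in> V \<Longrightarrow> ph (face k) \<in> face_polys (face k) p"
    and v: "v \<in> vpolys p" "v' \<in> vpolys p"
  shows rhs2_add: "rhs2 ph (\<lambda>x. v x + v' x) = rhs2 ph v + rhs2 ph v'"
    and rhs2_scale: "rhs2 ph (\<lambda>x. c *s v x) = cnj c * rhs2 ph v"
proof -
  have "face_ip V (face k) (ph (face k)) (\<lambda>x. ncomp (nrm k) v x + ncomp (nrm k) v' x) =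
      face_ip V (face k) (ph (face k)) (ncomp (nrm k) v) + face_ip V (face k) (ph (face k)) (ncomp (nrm k) v')"
    if k: "k \<in> V" for k
    by (intro face_ip_add_right k continuous_on_polys[OF polys_ncomp[OF v(1)]]
        continuous_on_polys[OF polys_ncomp[OF v(2)]] continuous_on_face_polys[OF ph])
  then show "rhs2 ph (\<lambda>x. v x + v' x) = rhs2 ph v + rhs2 ph v'"
    by (simp add: rhs2_def ncomp_add sum.distrib)
  show "rhs2 ph (\<lambda>x. c *s v x) = cnj c * rhs2 ph v"
    by (simp add: rhs2_def ncomp_scale sum_distrib_left face_ip_scale_right)
qed

text \<open>A pair \<open>(f, u)\<close> is encoded as one scalar function on \<open>'n option \<times> (real^'n)\<close>: the index
  \<open>None\<close> carries \<open>f\<close> and \<open>Some i\<close> carries the component \<open>u\<^sub>i\<close>.\<close>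

definition scalar_part :: "('n option \<times> (real^'n) \<Rightarrow> complex) \<Rightarrow> real^'n \<Rightarrow> complex" where
  "scalar_part w = (\<lambda>x. w (None, x))"

definition vector_part :: "('n option \<times> (real^'n) \<Rightarrow> complex) \<Rightarrow> real^'n \<Rightarrow> complex^'n" where
  "vector_part w = (\<lambda>x. \<chi> i. w (Some i, x))"

definition pair_basis :: "'n option \<times> ('n \<Rightarrow> nat) \<Rightarrow> 'n option \<times> (real^'n) \<Rightarrow> complex" where
  "pair_basis j y = (if fst j = fst y then monomial (snd j) (snd y) else 0)"

lemma pair_parts_add:
  "scalar_part (\<lambda>y. w y + w' y) = (\<lambda>x. scalar_part w x + scalar_part w' x)"
  "vector_part (\<lambda>y. w y + w' y) = (\<lambda>x. vector_part w x + vector_part w' x)"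
  by (simp_all add: scalar_part_def vector_part_def fun_eq_iff vec_eq_iff)

lemma pair_parts_scale:
  "scalar_part (\<lambda>y. c * w y) = (\<lambda>x. c * scalar_part w x)"
  "vector_part (\<lambda>y. c * w y) = (\<lambda>x. c *s vector_part w x)"
  by (simp_all add: scalar_part_def vector_part_def fun_eq_iff vec_eq_iff)

text \<open>A sum over pairs of indices collapses to the slot selected by the first component, so
  the coefficients for \<open>f\<close> and for each component of \<open>u\<close> are independent
  of each other.\<close>

lemma pair_span_iff:
  "w \<in> function_span pair_basis (UNIV \<times> multi_indices p) \<longleftrightarrow> scalar_part w \<in> polys p \<and> vector_part w \<in> vpolys p"
proof -
  have sum: "(\<Sum>j\<in>UNIV \<times> multi_indices p. c j * pair_basis j (o', x)) =
      (\<Sum>\<alpha>\<in>multi_indices p. c (o', \<alpha>) * monomial \<alpha> x)" for c :: "'n option \<times> ('n \<Rightarrow> nat) \<Rightarrow> complex" and o' x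
  proof -
    have "(\<Sum>j\<in>UNIV \<times> multi_indices p. c j * pair_basis j (o', x)) =
        (\<Sum>o''\<in>UNIV. \<Sum>\<alpha>\<in>multi_indices p. c (o'', \<alpha>) * pair_basis (o'', \<alpha>) (o', x))"
      by (simp add: sum.cartesian_product case_prod_unfold)
    also have "\<dots> = (\<Sum>o''\<in>UNIV. if o'' = o' then \<Sum>\<alpha>\<in>multi_indices p. c (o'', \<alpha>) * monomial \<alpha> x else 0)"
      by (intro sum.cong refl) (simp add: pair_basis_def)
    finally show ?thesis by simp
  qed
  have "w \<in> function_span pair_basis (UNIV \<times> multi_indices p) \<longleftrightarrow> (\<forall>o'. (\<lambda>x. w (o', x)) \<in> polys p)"
  proof
    assume "w \<in> function_span pair_basis (UNIV \<times> multi_indices p)"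
    then obtain c where "w = (\<lambda>y. \<Sum>j\<in>UNIV \<times> multi_indices p. c j * pair_basis j y)"
      by (auto simp: function_span_def)
    then have "w (o', x) = (\<Sum>\<alpha>\<in>multi_indices p. c (o', \<alpha>) * monomial \<alpha> x)" for o' x
      using sum by simp
    then show "\<forall>o'. (\<lambda>x. w (o', x)) \<in> polys p"
      unfolding polys_eq_span by (intro allI function_spanI)
  next
    assume "\<forall>o'. (\<lambda>x. w (o', x)) \<in> polys p"
    then have "\<forall>o'. \<exists>c. (\<lambda>x. w (o', x)) = (\<lambda>x. \<Sum>\<alpha>\<in>multi_indices p. c \<alpha> * monomial \<alpha> x)"
      unfolding polys_eq_span by (simp add: function_span_def)
    then obtain c where c: "\<And>o'. (\<lambda>x. w (o', x)) = (\<lambda>x. \<Sum>\<alpha>\<in>multi_indices p. c o' \<alpha> * monomial \<alpha> x)"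
      by metis
    have "w y = (\<Sum>j\<in>UNIV \<times> multi_indices p. c (fst j) (snd j) * pair_basis j y)" for y
      using fun_cong[OF c[of "fst y"], of "snd y"] sum[of "\<lambda>j. c (fst j) (snd j)" "fst y" "snd y"] by simp
    then show "w \<in> function_span pair_basis (UNIV \<times> multi_indices p)"
      by (rule function_spanI)
  qed
  also have "\<dots> \<longleftrightarrow> scalar_part w \<in> polys p \<and> vector_part w \<in> vpolys p"
    by (simp add: scalar_part_def vector_part_def vpolys_def split_option_all)
  finally show ?thesis .
qed

lemma pair_exhaust:
  obtains w where "scalar_part w = f" "vector_part w = u"
proof
  let ?w = "\<lambda>y. case fst y of None \<Rightarrow> f (snd y) | Some i \<Rightarrow> u (snd y) $ i"
  show "scalar_part ?w = f" "vector_part ?w = u"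
    by (simp_all add: scalar_part_def vector_part_def fun_eq_iff vec_eq_iff)
qed

theorem solution_exists:
  assumes ph: "\<And>k. k \<in> V \<Longrightarrow> ph (face k) \<in> face_polys (face k) p"
  shows "\<exists>f u. f \<in> polys p \<and> u \<in> vpolys p \<and> (\<forall>q\<in>polys p. form1 f u q = rhs1 ph q) \<and>
    (\<forall>v\<in>vpolys p. form2 f u v = rhs2 ph v)"
proof -
  let ?J = "UNIV \<times> multi_indices p :: ('n option \<times> ('n \<Rightarrow> nat)) set"
  define W where "W = function_span pair_basis ?J"
  have W: "w \<in> W \<longleftrightarrow> scalar_part w \<in> polys p \<and> vector_part w \<in> vpolys p" for w
    unfolding W_def by (rule pair_span_iff)
  \<comment> \<open>The two equations are merged into a single one on pairs; \<open>test\<close>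
    separates them again.\<close>
  define B where "B w z = form1 (scalar_part w) (vector_part w) (scalar_part z) +
    form2 (scalar_part w) (vector_part w) (vector_part z)" for w z
  define r where "r z = rhs1 ph (scalar_part z) + rhs2 ph (vector_part z)" for z
  have form_zero: "form1 f u (\<lambda>x. 0) = 0" "form2 f u (\<lambda>x. 0) = 0" if "f \<in> polys p" "u \<in> vpolys p" for f u
    using form1_scale_right[OF that polys_zero, of 0] form2_scale_right[OF vpolys_zero, of f u 0] by simp_all
  have rhs_zero: "rhs1 ph (\<lambda>x. 0) = 0" "rhs2 ph (\<lambda>x. 0) = 0"
    using rhs1_scale[OF ph polys_zero polys_zero, where c=0] rhs2_scale[OF ph vpolys_zero vpolys_zero, where c=0]
    by simp_all
  \<comment> \<open>The test pairs \<open>(q, 0)\<close> and \<open>(0, v)\<close> split the merged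
    equation. General \<open>s1\<close> and \<open>s2\<close> cover both the homogeneous problem and
    the given data.\<close>
  have test: "(\<forall>q\<in>polys p. form1 f u q = s1 q) \<and> (\<forall>v\<in>vpolys p. form2 f u v = s2 v)"
    if "f \<in> polys p" "u \<in> vpolys p" "s1 (\<lambda>x. 0) = 0" "s2 (\<lambda>x. 0) = 0"
      and *: "\<And>z. z \<in> W \<Longrightarrow> form1 f u (scalar_part z) + form2 f u (vector_part z) = s1 (scalar_part z) + s2 (vector_part z)"
    for f u and s1 :: "(real^'n \<Rightarrow> complex) \<Rightarrow> complex" and s2 :: "(real^'n \<Rightarrow> complex^'n) \<Rightarrow> complex"
  proof (intro conjI ballI)
    fix q :: "real^'n \<Rightarrow> complex" assume q: "q \<in> polys p"
    obtain z where z: "scalar_part z = q" "vector_part z = (\<lambda>x. 0)"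
      by (rule pair_exhaust)
    then have "z \<in> W" using W q vpolys_zero by metis
    from *[OF this] show "form1 f u q = s1 q"
      using that form_zero[of f u] by (simp add: z)
  next
    fix v :: "real^'n \<Rightarrow> complex^'n" assume v: "v \<in> vpolys p"
    obtain z where z: "scalar_part z = (\<lambda>x. 0)" "vector_part z = v"
      by (rule pair_exhaust)
    then have "z \<in> W" using W v polys_zero by metis
    from *[OF this] show "form2 f u v = s2 v"
      using that form_zero[of f u] by (simp add: z)
  qed
  have "\<exists>w\<in>function_span pair_basis ?J. \<forall>z\<in>function_span pair_basis ?J. B w z = r z"
  proof (rule sesquilinear_problem_solvable; (unfold W_def[symmetric])?)
    show "finite ?J"
      by (intro finite_cartesian_product finite_multi_indices) simp
    show "B (\<lambda>x. w x + w' x) z = B w z + B w' z" if "w \<in> W" "w' \<in> W" "z \<in> W" for w w' z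
      using that by (simp add: W B_def pair_parts_add form1_add form2_add)
    show "B (\<lambda>x. c * w x) z = c * B w z" if "w \<in> W" "z \<in> W" for c w z
      using that by (simp add: W B_def pair_parts_scale form1_scale form2_scale distrib_left)
    show "B w (\<lambda>x. z x + z' x) = B w z + B w z'" if "w \<in> W" "z \<in> W" "z' \<in> W" for w z z'
      using that by (simp add: W B_def pair_parts_add form1_add_right form2_add_right)
    show "B w (\<lambda>x. c * z x) = cnj c * B w z" if "w \<in> W" "z \<in> W" for c w z
      using that by (simp add: W B_def pair_parts_scale form1_scale_right form2_scale_right distrib_left)
    show "r (\<lambda>x. z x + z' x) = r z + r z'" if "z \<in> W" "z' \<in> W" for z z'
      using that by (simp add: W r_def pair_parts_add rhs1_add[OF ph] rhs2_add[OF ph])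
    show "r (\<lambda>x. c * z x) = cnj c * r z" if "z \<in> W" for c z
      using that rhs1_scale[OF ph, of "scalar_part z" "scalar_part z" c]
        rhs2_scale[OF ph, of "vector_part z" "vector_part z" c]
      by (simp add: W r_def pair_parts_scale distrib_left)
    show "w = (\<lambda>x. 0)" if w: "w \<in> W" and z: "\<And>z. z \<in> W \<Longrightarrow> B w z = 0" for w
    proof -
      have w': "scalar_part w \<in> polys p" "vector_part w \<in> vpolys p" using w W by auto
      have "(\<forall>q\<in>polys p. form1 (scalar_part w) (vector_part w) q = 0) \<and>
          (\<forall>v\<in>vpolys p. form2 (scalar_part w) (vector_part w) v = 0)"
        by (rule test[OF w']) (use z in \<open>simp_all add: B_def\<close>)
      then have "scalar_part w = (\<lambda>x. 0) \<and> vector_part w = (\<lambda>x. 0)"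
        by (intro homogeneous_solution_zero w') auto
      then have "w (o', x) = 0" for o' x
        by (cases o') (simp_all add: scalar_part_def vector_part_def fun_eq_iff vec_eq_iff)
      then show ?thesis by (auto simp: fun_eq_iff)
    qed
  qed
  then obtain w where w: "w \<in> W" "\<And>z. z \<in> W \<Longrightarrow> B w z = r z"
    unfolding W_def by blast
  have w': "scalar_part w \<in> polys p" "vector_part w \<in> vpolys p" using w W by auto
  have "(\<forall>q\<in>polys p. form1 (scalar_part w) (vector_part w) q = rhs1 ph q) \<and>
      (\<forall>v\<in>vpolys p. form2 (scalar_part w) (vector_part w) v = rhs2 ph v)"
    by (rule test[where ?s1.0 = "rhs1 ph" and ?s2.0 = "rhs2 ph", OF w' rhs_zero]) (use w in \<open>simp add: B_def r_def\<close>)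
  with w' show ?thesis by blast
qed

lemma solution_unique:
  assumes f: "f \<in> polys p" "f' \<in> polys p" and u: "u \<in> vpolys p" "u' \<in> vpolys p"
    and eq1: "\<And>q. q \<in> polys p \<Longrightarrow> form1 f u q = form1 f' u' q"
    and eq2: "\<And>v. v \<in> vpolys p \<Longrightarrow> form2 f u v = form2 f' u' v"
  shows "f = f' \<and> u = u'"
proof -
  \<comment> \<open>Differences carry the factor \<open>- 1\<close>, the shape to which additivity
    and scaling of the forms apply.\<close>
  note f'' = polys_scale[OF f(2), of "- 1"] and u'' = vpolys_scale[OF u(2), of "- 1"]
  have "(\<lambda>x. f x + (- 1) * f' x) = (\<lambda>x. 0) \<and> (\<lambda>x. u x + (- 1) *s u' x) = (\<lambda>x. 0)"
  proof (rule homogeneous_solution_zero[OF polys_add[OF f(1) f''] vpolys_add[OF u(1) u'']])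
    show "form1 (\<lambda>x. f x + (- 1) * f' x) (\<lambda>x. u x + (- 1) *s u' x) q = 0" if "q \<in> polys p" for q
      unfolding form1_add[OF f(1) f'' u(1) u'' that] form1_scale[OF f(2) u(2) that] by (simp add: eq1[OF that])
    show "form2 (\<lambda>x. f x + (- 1) * f' x) (\<lambda>x. u x + (- 1) *s u' x) v = 0" if "v \<in> vpolys p" for v
      unfolding form2_add[OF f(1) f'' u(1) u'' that] form2_scale by (simp add: eq2[OF that])
  qed
  then show ?thesis by (simp add: fun_eq_iff vec_eq_iff)
qed

end

theorem mainTheorem2:
  fixes V :: "(real^'n) set" and p :: nat and \<kappa> \<eta> :: real
    and A :: "(real^'n) set \<Rightarrow> (real^'n \<Rightarrow> complex) \<Rightarrow> (real^'n \<Rightarrow> complex)"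
  assumes dim: "CARD('n) = 2 \<or> CARD('n) = 3"
    and simplex: "finite V" "card V = CARD('n) + 1" "\<not> affine_dependent V"
    and kappa: "\<kappa> > 0" and eta: "\<eta> > 0"
    and Aop: "\<forall>F\<in>faces V. good_face_op V F p (A F)"
  shows "\<forall>ph :: (real^'n) set \<Rightarrow> (real^'n \<Rightarrow> complex).
           (\<forall>F\<in>faces V. ph F \<in> face_polys F p) \<longrightarrow>
           (\<exists>!(pK, uK). pK \<in> polys p \<and> uK \<in> vpolys p \<and>
              (\<forall>q\<in>polys p. \<forall>v\<in>vpolys p.
                 - \<i> * vol_ip (convex hull V) (\<lambda>x. complex_of_real (\<kappa> / \<eta>) * pK x) q
                 - vvol_ip (convex hull V) uK (grad q)
                 + (\<Sum>F\<in>faces V. face_ip V F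
                      (\<lambda>x. ncomp (normal V F) uK x
                           + inv_into (face_polys F p) (A F) (tr F pK) x) q)
                 = (\<Sum>F\<in>faces V. face_ip V F (inv_into (face_polys F p) (A F) (ph F)) q)
               \<and>
                 - \<i> * vvol_ip (convex hull V) (\<lambda>x. (\<kappa> * \<eta>) *\<^sub>R uK x) v
                 - vol_ip (convex hull V) pK (dvg v)
                 = - (\<Sum>F\<in>faces V. face_ip V F (ph F) (ncomp (normal V F) v))))"
proof -
  interpret full_simplex V
    by unfold_locales (use simplex in auto)
  interpret local_problem V p \<kappa> \<eta> A
    by unfold_locales (use kappa eta Aop in \<open>auto simp: faces_eq\<close>)
  show ?thesis
    unfolding sum_faces form1_def[symmetric] form2_def[symmetric] rhs1_def[symmetric] rhs2_def[symmetric]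
  proof (intro allI impI)
    fix ph assume "\<forall>F\<in>faces V. ph F \<in> face_polys F p"
    then have ph: "\<And>k. k \<in> V \<Longrightarrow> ph (face k) \<in> face_polys (face k) p"
      by (simp add: faces_eq)
    obtain f u where fu: "f \<in> polys p" "u \<in> vpolys p" "\<And>q. q \<in> polys p \<Longrightarrow> form1 f u q = rhs1 ph q"
      "\<And>v. v \<in> vpolys p \<Longrightarrow> form2 f u v = rhs2 ph v"
      using solution_exists[OF ph] by blast
    show "\<exists>!(pK, uK). pK \<in> polys p \<and> uK \<in> vpolys p \<and>
        (\<forall>q\<in>polys p. \<forall>v\<in>vpolys p. form1 pK uK q = rhs1 ph q \<and> form2 pK uK v = rhs2 ph v)"
    proof (rule ex1I[of _ "(f, u)"])
      fix s assume "case s of (pK, uK) \<Rightarrow> pK \<in> polys p \<and> uK \<in> vpolys p \<and>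
        (\<forall>q\<in>polys p. \<forall>v\<in>vpolys p. form1 pK uK q = rhs1 ph q \<and> form2 pK uK v = rhs2 ph v)"
      then obtain f' u' where s: "s = (f', u')" "f' \<in> polys p" "u' \<in> vpolys p"
        and eq: "\<And>q v. q \<in> polys p \<Longrightarrow> v \<in> vpolys p \<Longrightarrow> form1 f' u' q = rhs1 ph q \<and> form2 f' u' v = rhs2 ph v"
        by (cases s) auto
      have "f' = f \<and> u' = u"
      proof (rule solution_unique[OF s(2) fu(1) s(3) fu(2)])
        \<comment> \<open>The joint quantification over \<open>q\<close> and \<open>v\<close> is
          split by pairing each test function with zero.\<close>
        show "form1 f' u' q = form1 f u q" if "q \<in> polys p" for q
          using eq[OF that vpolys_zero] fu(3)[OF that] by simp
        show "form2 f' u' v = form2 f u v" if "v \<in> vpolys p" for v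
          using eq[OF polys_zero that] fu(4)[OF that] by simp
      qed
      with s show "s = (f, u)" by simp
    qed (use fu in simp)
  qed
qed

end
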